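(* Let $N\ge2$, let $A=(a_{ij})_{i,j=0}^{N-1}$ be an $N\times N$ unitary matrix with constant first row $\frac1{\sqrt N}$ (i.e. $a_{0j}=\frac{1}{\sqrt N}$ for all $j$), let $\mathcal{R}(x)=Nx \bmod 1$ on $[0,1]$, let $$m_i(x)=\sqrt N\sum_{j=0}^{N-1}a_{ij}\chi_{[j/N,(j+1)/N)}(x),\qquad i\in\mathbb{Z}_N,$$ and define the operators on $L^2[0,1]$ by $S_if=m_i\cdot(f\circ\mathcal{R})$, $f\in L^2[0,1]$, $i\in\mathbb{Z}_N$. Then the operators $(S_i)_{i\in\mathbb{Z}_N}$ form a permutative representation of $\mathcal{O}_N$ with permutative basis $$\{S_w1:w\text{ finite word, either empty or ending in }1\},$$ where in $S_w1$ the symbol $1$ denotes the constant function. The encoding map $E$ associates to such a word $w$ the infinite word $E(w)=w\underline0$, and it is injective. The maps $\sigma_l$ are $\sigma_0(\emptyset)=\emptyset$, $\sigma_l(\emptyset)=l$ for $l\neq0$, and $\sigma_l(w)=lw$ for $w\neq\emptyset$. The representation is irreducible, purely atomic, and supported on the set of infinite words ending in $\underline0$. Every finite dimensional subspace $M$ which is invariant for all $S_l^*$, $l\in\mathbb{Z}_N$, must contain the constant function $1$.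
   Context: $\mathbb{Z}_N=\{0,1,\dots,N-1\}$. A representation of the Cuntz algebra $\mathcal{O}_N$ on a Hilbert space $\mathcal{H}$ is a family $(S_i)_{i\in\mathbb{Z}_N}$ of bounded operators on $\mathcal{H}$ with $S_i^*S_j=\delta_{ij}I$ for all $i,j$ and $\sum_{i\in\mathbb{Z}_N}S_iS_i^*=I$. Finite words are over the alphabet $\mathbb{Z}_N$; for a finite word $w=i_1\dots i_n$, $S_w:=S_{i_1}\cdots S_{i_n}$ ($S_\emptyset$ is the identity, $\emptyset$ being the empty word). $\underline0$ denotes the infinite word $000\dots$. A representation is permutative with permutative basis $\{e_\lambda:\lambda\in\Lambda\}$ if this is an orthonormal basis and for all $\lambda\in\Lambda$, $j\in\mathbb{Z}_N$, $S_je_\lambda$ is an element of this basis; write $S_je_\lambda=e_{\sigma_j(\lambda)}$. The maps $\sigma_j:\Lambda\to\Lambda$ are injective with disjoint ranges whose union is $\Lambda$; let $\sigma:\Lambda\to\Lambda$ be the map with $\sigma(\sigma_j(\lambda))=\lambda$. The encoding map $E:\Lambda\to\mathcal{K}_N=\mathbb{Z}_N^{\mathbb{N}}$ is $E(\lambda)=j_0j_1j_2\dots$, where $\sigma^k(\lambda)\in\sigma_{j_k}(\Lambda)$ for all $k\ge0$. Here the basis is indexed by the words $w$ in the claim, with $e_w=S_w1$. The projection valued measure $P$ associated to the representation is the unique projection valued measure on the Borel sets of $\mathcal{K}_N$ (product topology) with $P(\{\omega:\omega_1=i_1,\dots,\omega_k=i_k\})=S_IS_I^*$ for every finite word $I=i_1\dots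 i_k$. The representation is purely atomic and supported on $\Omega\subset\mathcal{K}_N$ if $\oplus_{\omega\in\Omega}P(\{\omega\})$ is the identity.
   Formalization: The basis words are those that are empty or end in a nonzero letter, instead of "ending in 1" (the same for N=2; for N>2 the literal claim fails, since S_2 1 is orthogonal to the stated set); the finite dimensional invariant subspace M is required to be nonzero. *)

theory Defs
  imports "HOL-Analysis.Analysis" "Jordan_Normal_Form.Schur_Decomposition"
begin

class scaleC =
  fixes scaleC :: "complex \<Rightarrow> 'a \<Rightarrow> 'a" (infixr "*\<^sub>C" 75)

text \<open>
  The inner product \<open>cinner\<close> is linear in its first argument.  Norm and topology are those of the
  underlying real inner product space, whose inner product is the real part of \<open>cinner\<close>.
\<close>

class complex_inner = real_inner + scaleC +
  fixes cinner :: "'a \<Rightarrow> 'a \<Rightarrow> complex"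
  assumes scaleC_add_right: "c *\<^sub>C (x + y) = c *\<^sub>C x + c *\<^sub>C y"
    and scaleC_add_left: "(c + d) *\<^sub>C x = c *\<^sub>C x + d *\<^sub>C x"
    and scaleC_scaleC: "c *\<^sub>C (d *\<^sub>C x) = (c * d) *\<^sub>C x"
    and scaleR_scaleC: "r *\<^sub>R x = complex_of_real r *\<^sub>C x"
    and cinner_commute: "cinner x y = cnj (cinner y x)"
    and cinner_add_left: "cinner (x + y) z = cinner x z + cinner y z"
    and cinner_scaleC_left: "cinner (c *\<^sub>C x) y = c * cinner x y"
    and inner_eq_Re_cinner: "inner x y = Re (cinner x y)"

class complex_hilbert = complex_inner + complete_space

abbreviation csubspace :: "'a::complex_inner set \<Rightarrow> bool" where
  "csubspace \<equiv> Modules.module.subspace scaleC"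

abbreviation cspan :: "'a::complex_inner set \<Rightarrow> 'a set" where
  "cspan \<equiv> Modules.module.span scaleC"

lemma vector_space_scaleC: "vector_space (scaleC :: complex \<Rightarrow> 'a::complex_inner \<Rightarrow> 'a)"
proof
  fix c d :: complex and x y :: 'a
  show "c *\<^sub>C (x + y) = c *\<^sub>C x + c *\<^sub>C y" by (rule scaleC_add_right)
  show "(c + d) *\<^sub>C x = c *\<^sub>C x + d *\<^sub>C x" by (rule scaleC_add_left)
  show "c *\<^sub>C d *\<^sub>C x = (c * d) *\<^sub>C x" by (rule scaleC_scaleC)
  show "1 *\<^sub>C x = x" using scaleR_scaleC[of 1 x] by simp
qed

definition finite_dim :: "'a::complex_inner set \<Rightarrow> bool" where
  "finite_dim M \<longleftrightarrow> (\<exists>B. finite B \<and> M = cspan B)"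

definition bounded_clinear :: "('a::complex_inner \<Rightarrow> 'a) \<Rightarrow> bool" where
  "bounded_clinear T \<longleftrightarrow> bounded_linear T \<and> (\<forall>c x. T (c *\<^sub>C x) = c *\<^sub>C T x)"

definition cadjoint :: "('a::complex_inner \<Rightarrow> 'a) \<Rightarrow> 'a \<Rightarrow> 'a" where
  "cadjoint T = (THE T'. \<forall>x y. cinner (T x) y = cinner x (T' y))"

definition is_projection :: "('a::complex_inner \<Rightarrow> 'a) \<Rightarrow> bool" where
  "is_projection Q \<longleftrightarrow> bounded_clinear Q \<and> Q \<circ> Q = Q \<and> (\<forall>x y. cinner (Q x) y = cinner x (Q y))"

definition orthonormal_basis :: "'i set \<Rightarrow> ('i \<Rightarrow> 'a::complex_inner) \<Rightarrow> bool" where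
  "orthonormal_basis \<Lambda> e \<longleftrightarrow>
     (\<forall>l\<in>\<Lambda>. \<forall>k\<in>\<Lambda>. cinner (e l) (e k) = (if l = k then 1 else 0)) \<and>
     closure (cspan (e ` \<Lambda>)) = UNIV"

text \<open>
  A family of operators indexed by \<open>{0,\<dots>,N-1}\<close> is a function on \<open>nat\<close>, of which only the values at
  arguments below \<open>N\<close> matter.
\<close>

definition cuntz_rep :: "nat \<Rightarrow> (nat \<Rightarrow> 'a::complex_hilbert \<Rightarrow> 'a) \<Rightarrow> bool" where
  "cuntz_rep N S \<longleftrightarrow>
     (\<forall>i<N. bounded_clinear (S i)) \<and>
     (\<forall>i<N. \<forall>j<N. \<forall>x. cadjoint (S i) (S j x) = (if i = j then x else 0)) \<and>
     (\<forall>x. (\<Sum>i<N. S i (cadjoint (S i) x)) = x)"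

definition word_op :: "(nat \<Rightarrow> 'a \<Rightarrow> 'a) \<Rightarrow> nat list \<Rightarrow> 'a \<Rightarrow> 'a" where
  "word_op S w = foldr (\<lambda>i T. S i \<circ> T) w id"

definition irreducible_rep :: "nat \<Rightarrow> (nat \<Rightarrow> 'a::complex_hilbert \<Rightarrow> 'a) \<Rightarrow> bool" where
  "irreducible_rep N S \<longleftrightarrow>
     (\<forall>M. csubspace M \<and> closed M \<and> (\<forall>i<N. S i ` M \<subseteq> M \<and> cadjoint (S i) ` M \<subseteq> M)
        \<longrightarrow> M = {0} \<or> M = UNIV)"

definition permutative_basis ::
  "nat \<Rightarrow> (nat \<Rightarrow> 'a::complex_hilbert \<Rightarrow> 'a) \<Rightarrow> 'i set \<Rightarrow> ('i \<Rightarrow> 'a) \<Rightarrow> bool" where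
  "permutative_basis N S \<Lambda> e \<longleftrightarrow>
     orthonormal_basis \<Lambda> e \<and> (\<forall>l\<in>\<Lambda>. \<forall>j<N. S j (e l) \<in> e ` \<Lambda>)"

text \<open>
  The descriptions below are meant for \<open>l \<in> \<Lambda>\<close> and \<open>j < N\<close>; there they are uniquely satisfied when
  \<open>e\<close> is a permutative basis of the representation \<open>S\<close>.
\<close>

definition branch_map ::
  "(nat \<Rightarrow> 'a \<Rightarrow> 'a) \<Rightarrow> 'i set \<Rightarrow> ('i \<Rightarrow> 'a) \<Rightarrow> nat \<Rightarrow> 'i \<Rightarrow> 'i" where
  "branch_map S \<Lambda> e j l = (THE \<mu>. \<mu> \<in> \<Lambda> \<and> S j (e l) = e \<mu>)"

definition coding_shift ::
  "nat \<Rightarrow> (nat \<Rightarrow> 'a \<Rightarrow> 'a) \<Rightarrow> 'i set \<Rightarrow> ('i \<Rightarrow> 'a) \<Rightarrow> 'i \<Rightarrow> 'i" where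
  "coding_shift N S \<Lambda> e l = (THE \<mu>. \<mu> \<in> \<Lambda> \<and> (\<exists>j<N. branch_map S \<Lambda> e j \<mu> = l))"

definition encoding ::
  "nat \<Rightarrow> (nat \<Rightarrow> 'a \<Rightarrow> 'a) \<Rightarrow> 'i set \<Rightarrow> ('i \<Rightarrow> 'a) \<Rightarrow> 'i \<Rightarrow> nat \<Rightarrow> nat" where
  "encoding N S \<Lambda> e l k =
     (THE j. j < N \<and> (coding_shift N S \<Lambda> e ^^ k) l \<in> branch_map S \<Lambda> e j ` \<Lambda>)"

definition inf_words :: "nat \<Rightarrow> (nat \<Rightarrow> nat) set" where
  "inf_words N = {\<omega>. \<forall>k. \<omega> k < N}"

text \<open>
  The type \<open>nat \<Rightarrow> nat\<close> carries the product topology of discrete spaces, hence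
  \<open>restrict_space borel (inf_words N)\<close> carries the Borel sets of the compact space of infinite words.
\<close>

definition words_borel :: "nat \<Rightarrow> (nat \<Rightarrow> nat) measure" where
  "words_borel N = restrict_space borel (inf_words N)"

definition cylinder :: "nat \<Rightarrow> nat list \<Rightarrow> (nat \<Rightarrow> nat) set" where
  "cylinder N w = {\<omega> \<in> inf_words N. \<forall>k<length w. \<omega> k = w ! k}"

definition is_pvm :: "'b measure \<Rightarrow> ('b set \<Rightarrow> 'a::complex_hilbert \<Rightarrow> 'a) \<Rightarrow> bool" where
  "is_pvm M P \<longleftrightarrow>
     (\<forall>B\<in>sets M. is_projection (P B)) \<and>
     P {} = (\<lambda>x. 0) \<and> P (space M) = id \<and>
     (\<forall>B\<in>sets M. \<forall>C\<in>sets M. P (B \<inter> C) = P B \<circ> P C) \<and>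
     (\<forall>B. range B \<subseteq> sets M \<and> disjoint_family B \<longrightarrow>
        (\<forall>x. (\<lambda>n::nat. P (B n) x) sums P (\<Union>n. B n) x))"

definition is_cuntz_pvm ::
  "nat \<Rightarrow> (nat \<Rightarrow> 'a::complex_hilbert \<Rightarrow> 'a) \<Rightarrow> ((nat \<Rightarrow> nat) set \<Rightarrow> 'a \<Rightarrow> 'a) \<Rightarrow> bool" where
  "is_cuntz_pvm N S P \<longleftrightarrow>
     is_pvm (words_borel N) P \<and>
     (\<forall>w. set w \<subseteq> {..<N} \<longrightarrow> P (cylinder N w) = word_op S w \<circ> cadjoint (word_op S w))"

text \<open>
  The projection valued measure of a representation is unique on Borel sets, so the existential
  quantifier over \<open>P\<close> only names it.  The sum is the unordered, pointwise norm-convergent one; the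
  ranges of the \<open>P {\<omega>}\<close> are mutually orthogonal for every projection valued measure.
\<close>

definition purely_atomic_on ::
  "nat \<Rightarrow> (nat \<Rightarrow> 'a::complex_hilbert \<Rightarrow> 'a) \<Rightarrow> (nat \<Rightarrow> nat) set \<Rightarrow> bool" where
  "purely_atomic_on N S \<Omega> \<longleftrightarrow>
     \<Omega> \<subseteq> inf_words N \<and>
     (\<exists>P. is_cuntz_pvm N S P \<and> (\<forall>x. ((\<lambda>\<omega>. P {\<omega>} x) has_sum x) \<Omega>))"

abbreviation UI :: "real measure" where
  "UI \<equiv> restrict_space lborel {0..1}"

definition sq_integrable :: "(real \<Rightarrow> complex) \<Rightarrow> bool" where
  "sq_integrable f \<longleftrightarrow> f \<in> borel_measurable UI \<and> integrable UI (\<lambda>x. (cmod (f x))\<^sup>2)"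

lemma space_UI [simp]: "space UI = {0..1}"
  by (simp add: space_restrict_space)

lemma emeasure_UI [simp]: "emeasure UI (space UI) = 1"
  by (subst emeasure_restrict_space) auto

lemma finite_measure_UI: "finite_measure UI"
  by (rule finite_measureI) (metis emeasure_UI ennreal_one_neq_top infinity_ennreal_def)

lemma sq_integrable_bounded:
  assumes "f \<in> borel_measurable UI" "\<And>x. cmod (f x) \<le> B"
  shows "sq_integrable f"
  unfolding sq_integrable_def
proof (intro conjI)
  interpret finite_measure UI by (rule finite_measure_UI)
  show "integrable UI (\<lambda>x. (cmod (f x))\<^sup>2)"
    by (rule integrable_const_bound[where B="B\<^sup>2"])
       (use assms in \<open>auto intro!: power_mono\<close>)
qed (fact assms)

lemma sq_integrable_mult:
  assumes f: "sq_integrable f" and g: "sq_integrable g"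
  shows "integrable UI (\<lambda>x. f x * cnj (g x))"
proof (rule Bochner_Integration.integrable_bound)
  show "integrable UI (\<lambda>x. (cmod (f x))\<^sup>2 + (cmod (g x))\<^sup>2)"
    using f g by (auto simp: sq_integrable_def)
  have [measurable]: "f \<in> borel_measurable UI" "g \<in> borel_measurable UI"
    using f g by (auto simp: sq_integrable_def)
  have "(\<lambda>x. cnj (g x)) \<in> borel_measurable UI"
    by (rule borel_measurable_continuous_on[of cnj]) (auto intro!: continuous_intros)
  then show "(\<lambda>x. f x * cnj (g x)) \<in> borel_measurable UI" by measurable
  have "a * b \<le> a\<^sup>2 + b\<^sup>2" for a b :: real
    using sum_squares_bound[of a b] sum_power2_ge_zero[of a b] by linarith
  then show "AE x in UI. norm (f x * cnj (g x)) \<le> norm ((cmod (f x))\<^sup>2 + (cmod (g x))\<^sup>2)"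
    by (auto simp: norm_mult)
qed

lemma sq_integrable_add:
  assumes f: "sq_integrable f" and g: "sq_integrable g"
  shows "sq_integrable (\<lambda>x. f x + g x)"
  unfolding sq_integrable_def
proof (intro conjI)
  have [measurable]: "f \<in> borel_measurable UI" "g \<in> borel_measurable UI"
    using f g by (auto simp: sq_integrable_def)
  show "(\<lambda>x. f x + g x) \<in> borel_measurable UI" by measurable
  have le: "(cmod (a + b))\<^sup>2 \<le> 2 * (cmod a)\<^sup>2 + 2 * (cmod b)\<^sup>2" for a b
  proof -
    have "(cmod (a + b))\<^sup>2 \<le> (cmod a + cmod b)\<^sup>2"
      by (intro power_mono norm_triangle_ineq) auto
    also have "\<dots> \<le> 2 * (cmod a)\<^sup>2 + 2 * (cmod b)\<^sup>2"
      using sum_squares_bound[of "cmod a" "cmod b"] by (simp add: power2_sum)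
    finally show ?thesis .
  qed
  show "integrable UI (\<lambda>x. (cmod (f x + g x))\<^sup>2)"
  proof (rule Bochner_Integration.integrable_bound)
    show "integrable UI (\<lambda>x. 2 * (cmod (f x))\<^sup>2 + 2 * (cmod (g x))\<^sup>2)"
      using f g by (auto simp: sq_integrable_def)
    show "AE x in UI. norm ((cmod (f x + g x))\<^sup>2) \<le> norm (2 * (cmod (f x))\<^sup>2 + 2 * (cmod (g x))\<^sup>2)"
      using le by auto
  qed measurable
qed

lemma sq_integrable_scale:
  assumes "sq_integrable f"
  shows "sq_integrable (\<lambda>x. c * f x)"
  using assms by (auto simp: sq_integrable_def norm_mult power_mult_distrib)

lemma sq_integrable_uminus: "sq_integrable f \<Longrightarrow> sq_integrable (\<lambda>x. - f x)"
  using sq_integrable_scale[of f "-1"] by simp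

lemma sq_integrable_diff:
  "sq_integrable f \<Longrightarrow> sq_integrable g \<Longrightarrow> sq_integrable (\<lambda>x. f x - g x)"
  using sq_integrable_add[OF _ sq_integrable_uminus, of f g] by simp

lemma sq_integrable_const: "sq_integrable (\<lambda>x. c)"
  by (rule sq_integrable_bounded[where B="cmod c"]) auto

lemma AE_UI_eq_trans:
  "AE x in UI. f x = g x \<Longrightarrow> AE x in UI. g x = h x \<Longrightarrow> AE x in UI. f x = h x"
  by (auto elim: eventually_elim2)

text \<open>
  Square integrable Borel functions with respect to Lebesgue measure on the unit interval, modulo
  equality almost everywhere; values outside the interval are irrelevant.  Every Lebesgue measurable
  class has a Borel representative, so this is the usual space.
\<close>

quotient_type L2 = "real \<Rightarrow> complex" /
  partial: "\<lambda>f g. sq_integrable f \<and> sq_integrable g \<and> (AE x in UI. f x = g x)"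
proof (rule part_equivpI)
  show "\<exists>f. sq_integrable f \<and> sq_integrable f \<and> (AE x in UI. f x = f x)"
    using sq_integrable_const by auto
  show "symp (\<lambda>f g. sq_integrable f \<and> sq_integrable g \<and> (AE x in UI. f x = g x))"
    by (auto intro!: sympI elim: eventually_mono)
  show "transp (\<lambda>f g. sq_integrable f \<and> sq_integrable g \<and> (AE x in UI. f x = g x))"
    by (intro transpI conjI) (blast intro: AE_UI_eq_trans)+
qed

instantiation L2 :: complex_inner
begin

lift_definition zero_L2 :: L2 is "\<lambda>x. 0"
  by (auto intro: sq_integrable_const)

lift_definition plus_L2 :: "L2 \<Rightarrow> L2 \<Rightarrow> L2" is "\<lambda>f g x. f x + g x"
  by (auto intro: sq_integrable_add elim: eventually_elim2)

lift_definition minus_L2 :: "L2 \<Rightarrow> L2 \<Rightarrow> L2" is "\<lambda>f g x. f x - g x"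
  by (auto intro: sq_integrable_diff elim: eventually_elim2)

lift_definition uminus_L2 :: "L2 \<Rightarrow> L2" is "\<lambda>f x. - f x"
  by (auto intro: sq_integrable_uminus)

lift_definition scaleC_L2 :: "complex \<Rightarrow> L2 \<Rightarrow> L2" is "\<lambda>c f x. c * f x"
  by (auto intro: sq_integrable_scale elim: eventually_mono)

lift_definition cinner_L2 :: "L2 \<Rightarrow> L2 \<Rightarrow> complex" is "\<lambda>f g. \<integral>x. f x * cnj (g x) \<partial>UI"
proof -
  fix f f' g g' :: "real \<Rightarrow> complex"
  assume 1: "sq_integrable f \<and> sq_integrable f' \<and> (AE x in UI. f x = f' x)"
    and 2: "sq_integrable g \<and> sq_integrable g' \<and> (AE x in UI. g x = g' x)"
  show "(\<integral>x. f x * cnj (g x) \<partial>UI) = (\<integral>x. f' x * cnj (g' x) \<partial>UI)"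
  proof (rule integral_cong_AE)
    show "(\<lambda>x. f x * cnj (g x)) \<in> borel_measurable UI" "(\<lambda>x. f' x * cnj (g' x)) \<in> borel_measurable UI"
      using 1 2 sq_integrable_mult borel_measurable_integrable by blast+
    show "AE x in UI. f x * cnj (g x) = f' x * cnj (g' x)"
      using 1 2 by (auto elim: eventually_elim2)
  qed
qed

definition scaleR_L2 :: "real \<Rightarrow> L2 \<Rightarrow> L2" where
  "scaleR_L2 r f = complex_of_real r *\<^sub>C f"

definition inner_L2 :: "L2 \<Rightarrow> L2 \<Rightarrow> real" where
  "inner_L2 f g = Re (cinner f g)"

definition norm_L2 :: "L2 \<Rightarrow> real" where
  "norm_L2 f = sqrt (inner f f)"

definition dist_L2 :: "L2 \<Rightarrow> L2 \<Rightarrow> real" where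
  "dist_L2 f g = norm (f - g)"

definition sgn_L2 :: "L2 \<Rightarrow> L2" where
  "sgn_L2 f = inverse (norm f) *\<^sub>R f"

definition uniformity_L2 :: "(L2 \<times> L2) filter" where
  "uniformity_L2 = (INF e\<in>{0<..}. principal {(f, g). dist f g < e})"

definition open_L2 :: "L2 set \<Rightarrow> bool" where
  "open_L2 U \<longleftrightarrow> (\<forall>f\<in>U. \<forall>\<^sub>F (f', g) in uniformity. f' = f \<longrightarrow> g \<in> U)"

instance
proof
  fix f g h :: L2 and c d :: complex and r s :: real
  show "f + g + h = f + (g + h)"
    by transfer (auto simp: add.assoc intro: sq_integrable_add)
  show "f + g = g + f"
    by transfer (auto simp: add.commute intro: sq_integrable_add)
  show "0 + f = f" by transfer auto
  show "- f + f = 0" by transfer (auto intro: sq_integrable_const)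
  show "f - g = f + - g"
    by transfer (auto intro: sq_integrable_diff)
  show addr: "c *\<^sub>C (f + g) = c *\<^sub>C f + c *\<^sub>C g" for c
    by transfer (auto simp: distrib_left intro: sq_integrable_add sq_integrable_scale)
  show addl: "(c + d) *\<^sub>C f = c *\<^sub>C f + d *\<^sub>C f" for c d
    by transfer (auto simp: distrib_right intro: sq_integrable_add sq_integrable_scale)
  show assoc: "c *\<^sub>C d *\<^sub>C f = (c * d) *\<^sub>C f" for c d
    by transfer (auto simp: mult.assoc intro: sq_integrable_scale)
  have one: "1 *\<^sub>C f = f" by transfer auto
  show "r *\<^sub>R f = complex_of_real r *\<^sub>C f" by (rule scaleR_L2_def)
  show "r *\<^sub>R (f + g) = r *\<^sub>R f + r *\<^sub>R g" by (simp add: scaleR_L2_def addr)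
  show "(r + s) *\<^sub>R f = r *\<^sub>R f + s *\<^sub>R f" by (simp add: scaleR_L2_def addl)
  show "r *\<^sub>R s *\<^sub>R f = (r * s) *\<^sub>R f" by (simp add: scaleR_L2_def assoc)
  show "1 *\<^sub>R f = f" by (simp add: scaleR_L2_def one)
  show "sgn f = inverse (norm f) *\<^sub>R f" by (rule sgn_L2_def)
  show "dist f g = norm (f - g)" by (rule dist_L2_def)
  show "(uniformity :: (L2 \<times> L2) filter) = (INF e\<in>{0<..}. principal {(f, g). dist f g < e})"
    by (rule uniformity_L2_def)
  show "open U \<longleftrightarrow> (\<forall>f\<in>U. \<forall>\<^sub>F (f', g) in uniformity. f' = f \<longrightarrow> g \<in> U)" for U :: "L2 set"
    by (rule open_L2_def)
  show comm: "cinner f g = cnj (cinner g f)" for f g :: L2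
    by transfer (simp add: mult.commute flip: Bochner_Integration.integral_cnj)
  show add: "cinner (f + g) h = cinner f h + cinner g h"
    by transfer (auto simp: distrib_right sq_integrable_mult)
  show scale: "cinner (c *\<^sub>C f) g = c * cinner f g" for c
    by transfer (auto simp: mult.assoc)
  show "inner f g = Re (cinner f g)" by (rule inner_L2_def)
  show "inner f g = inner g f" using comm[of f g] by (simp add: inner_L2_def)
  show "inner (f + g) h = inner f h + inner g h" by (simp add: inner_L2_def add)
  show "inner (r *\<^sub>R f) g = r * inner f g" by (simp add: inner_L2_def scaleR_L2_def scale)
  show "norm f = sqrt (inner f f)" by (rule norm_L2_def)
  have sq: "f x * cnj (f x) = complex_of_real ((cmod (f x))\<^sup>2)" for f :: "real \<Rightarrow> complex" and x
    by (simp only: complex_norm_square)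
  show "0 \<le> inner f f"
    unfolding inner_L2_def by transfer (simp only: sq integral_complex_of_real, simp)
  show "(inner f f = 0) = (f = 0)"
    unfolding inner_L2_def
  proof (transfer, unfold sq integral_complex_of_real Re_complex_of_real)
    fix f :: "real \<Rightarrow> complex"
    assume "sq_integrable f \<and> sq_integrable f \<and> (AE x in UI. f x = f x)"
    then have f: "sq_integrable f" by simp
    have "(\<integral>x. (cmod (f x))\<^sup>2 \<partial>UI) = 0 \<longleftrightarrow> (AE x in UI. (cmod (f x))\<^sup>2 = 0)"
      using f by (intro integral_nonneg_eq_0_iff_AE) (auto simp: sq_integrable_def)
    then show "(\<integral>x. (cmod (f x))\<^sup>2 \<partial>UI) = 0 \<longleftrightarrow>
        sq_integrable f \<and> sq_integrable (\<lambda>x. 0) \<and> (AE x in UI. f x = 0)"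
      using f by (simp add: sq_integrable_const)
  qed
qed

end


lemma L2_cases:
  obtains f where "sq_integrable f" "F = abs_L2 f"
proof -
  have "\<exists>f. sq_integrable f \<and> F = abs_L2 f"
    by (induction F rule: L2.abs_induct) auto
  then show ?thesis using that by blast
qed

lemma norm_L2_sq: "sq_integrable f \<Longrightarrow> (norm (abs_L2 f))\<^sup>2 = (\<integral>x. (cmod (f x))\<^sup>2 \<partial>UI)"
proof -
  assume f: "sq_integrable f"
  have "complex_of_real ((norm (abs_L2 f))\<^sup>2) = complex_of_real (\<integral>x. (cmod (f x))\<^sup>2 \<partial>UI)"
  proof -
    have "(norm (abs_L2 f))\<^sup>2 = Re (cinner (abs_L2 f) (abs_L2 f))"
      by (simp add: power2_norm_eq_inner inner_L2_def)
    also have "cinner (abs_L2 f) (abs_L2 f) = (\<integral>x. f x * cnj (f x) \<partial>UI)"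
      using f by (simp add: cinner_L2.abs_eq)
    also have "\<dots> = complex_of_real (\<integral>x. (cmod (f x))\<^sup>2 \<partial>UI)"
      by (simp only: complex_norm_square[symmetric] of_real_power[symmetric] integral_complex_of_real)
    finally show ?thesis by simp
  qed
  then show ?thesis by (simp only: of_real_eq_iff)
qed

lemma nn_integral_L2:
  assumes "sq_integrable f"
  shows "(\<integral>\<^sup>+x. ennreal ((cmod (f x))\<^sup>2) \<partial>UI) = ennreal ((norm (abs_L2 f))\<^sup>2)"
  using assms by (subst nn_integral_eq_integral) (auto simp: norm_L2_sq sq_integrable_def)

lemma sq_integrable_L1:
  assumes f: "sq_integrable f" and le: "norm (abs_L2 f) \<le> \<epsilon>" and pos: "0 < \<epsilon>"
  shows "(\<integral>\<^sup>+x. ennreal (cmod (f x)) \<partial>UI) \<le> ennreal \<epsilon>"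
proof -
  interpret finite_measure UI by (rule finite_measure_UI)
  have i: "integrable UI (\<lambda>x. (cmod (f x))\<^sup>2)" and [measurable]: "f \<in> borel_measurable UI"
    using f by (auto simp: sq_integrable_def)
  have le2: "(norm (abs_L2 f))\<^sup>2 \<le> \<epsilon>\<^sup>2" using le by (intro power_mono) auto
  have m: "measure UI {0..1} = 1" using emeasure_UI by (simp add: measure_def)
  have amgm: "t \<le> \<epsilon> / 2 + t\<^sup>2 / (2 * \<epsilon>)" for t :: real
    using sum_squares_bound[of t \<epsilon>] pos by (simp add: field_simps power2_eq_square)
  have "(\<integral>\<^sup>+x. ennreal (cmod (f x)) \<partial>UI) \<le> (\<integral>\<^sup>+x. ennreal (\<epsilon> / 2 + (cmod (f x))\<^sup>2 / (2 * \<epsilon>)) \<partial>UI)"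
    by (intro nn_integral_mono ennreal_leI amgm)
  also have "\<dots> = ennreal (\<integral>x. \<epsilon> / 2 + (cmod (f x))\<^sup>2 / (2 * \<epsilon>) \<partial>UI)"
    using i pos by (intro nn_integral_eq_integral) auto
  also have "(\<integral>x. \<epsilon> / 2 + (cmod (f x))\<^sup>2 / (2 * \<epsilon>) \<partial>UI) = \<epsilon> / 2 + (norm (abs_L2 f))\<^sup>2 / (2 * \<epsilon>)"
    using i by (simp add: norm_L2_sq[OF f] m)
  also have "\<dots> \<le> \<epsilon> / 2 + \<epsilon>\<^sup>2 / (2 * \<epsilon>)"
    using le2 pos by (intro add_left_mono divide_right_mono) auto
  also have "\<dots> = \<epsilon>" using pos by (simp add: field_simps power2_eq_square)
  finally show ?thesis by (simp add: ennreal_leI)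
qed

lemma abs_L2_diff:
  "sq_integrable f \<Longrightarrow> sq_integrable g \<Longrightarrow> abs_L2 f - abs_L2 g = abs_L2 (\<lambda>x. f x - g x)"
  by (simp add: minus_L2.abs_eq)

instance L2 :: complex_hilbert
proof
  fix X :: "nat \<Rightarrow> L2"
  assume C: "Cauchy X"
  have "\<exists>M. \<forall>m\<ge>M. \<forall>n\<ge>M. dist (X m) (X n) < (1/2) ^ k" for k
    using C by (intro metric_CauchyD) auto
  then obtain M where M: "\<And>k m n. m \<ge> M k \<Longrightarrow> n \<ge> M k \<Longrightarrow> dist (X m) (X n) < (1/2) ^ k"
    by metis
  define r where "r k = (\<Sum>i\<le>k. M i) + k" for k
  have r: "strict_mono r" by (auto simp: strict_mono_Suc_iff r_def)
  have rM: "M k \<le> r j" if "k \<le> j" for k j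
  proof -
    have "M k \<le> (\<Sum>i\<le>j. M i)" using that by (intro member_le_sum) auto
    then show ?thesis by (simp add: r_def)
  qed
  have "\<exists>f. sq_integrable f \<and> X (r k) = abs_L2 f" for k by (rule L2_cases) blast
  then obtain f where f: "\<And>k. sq_integrable (f k)" and Xf: "\<And>k. X (r k) = abs_L2 (f k)"
    by metis
  have [measurable]: "f k \<in> borel_measurable UI" for k using f by (simp add: sq_integrable_def)
  define d where "d k x = f (Suc k) x - f k x" for k x
  have d: "sq_integrable (d k)" for k
    using f unfolding d_def by (intro sq_integrable_diff) auto
  have [measurable]: "d k \<in> borel_measurable UI" for k using d by (simp add: sq_integrable_def)
  have "norm (abs_L2 (d k)) \<le> (1/2) ^ k" for k
  proof -
    have "abs_L2 (d k) = X (r (Suc k)) - X (r k)"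
      unfolding Xf d_def using f by (simp add: abs_L2_diff)
    then show ?thesis
      using M[of k "r (Suc k)" "r k"] rM[of k k] rM[of k "Suc k"] by (simp add: dist_norm)
  qed
  then have d1: "(\<integral>\<^sup>+x. ennreal (cmod (d k x)) \<partial>UI) \<le> ennreal ((1/2) ^ k)" for k
    by (intro sq_integrable_L1 d) auto
  have "(\<integral>\<^sup>+x. (\<Sum>k. ennreal (cmod (d k x))) \<partial>UI) = (\<Sum>k. \<integral>\<^sup>+x. ennreal (cmod (d k x)) \<partial>UI)"
    by (rule nn_integral_suminf) measurable
  also have "\<dots> \<le> (\<Sum>k. ennreal ((1/2) ^ k))"
    by (intro suminf_le d1) auto
  also have "\<dots> = ennreal (\<Sum>k. (1/2) ^ k)"
    by (intro suminf_ennreal2 summable_geometric) auto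
  also have "\<dots> < \<infinity>" by simp
  finally have "(\<integral>\<^sup>+x. (\<Sum>k. ennreal (cmod (d k x))) \<partial>UI) \<noteq> \<infinity>" by simp
  then have "AE x in UI. (\<Sum>k. ennreal (cmod (d k x))) \<noteq> \<infinity>"
    by (intro nn_integral_PInf_AE) measurable
  then have "AE x in UI. convergent (\<lambda>k. f k x)"
  proof eventually_elim
    case (elim x)
    have "summable (\<lambda>k. cmod (d k x))"
      by (rule summable_suminf_not_top) (use elim in auto)
    then have "summable (\<lambda>k. d k x)" by (rule summable_norm_cancel)
    then have "convergent (\<lambda>n. \<Sum>k<n. d k x)" by (simp add: summable_iff_convergent)
    moreover have "(\<Sum>k<n. d k x) = f n x - f 0 x" for n
      unfolding d_def by (rule sum_lessThan_telescope)
    ultimately have "convergent (\<lambda>n. f n x - f 0 x)" by simp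
    then show ?case
      using convergent_add[OF _ convergent_const, of "\<lambda>n. f n x - f 0 x" "f 0 x"] by simp
  qed
  then have lim: "AE x in UI. (\<lambda>k. f k x) \<longlonglongrightarrow> lim (\<lambda>k. f k x)"
    by (auto simp: convergent_LIMSEQ_iff)
  define g where "g x = lim (\<lambda>k. f k x)" for x
  have [measurable]: "g \<in> borel_measurable UI"
    unfolding g_def by (rule borel_measurable_lim_metric) measurable
  have fatou: "(\<integral>\<^sup>+x. ennreal ((cmod (g x - f k x))\<^sup>2) \<partial>UI) \<le> ennreal (((1/2) ^ k)\<^sup>2)" for k
  proof -
    have "(\<integral>\<^sup>+x. ennreal ((cmod (g x - f k x))\<^sup>2) \<partial>UI)
        = (\<integral>\<^sup>+x. liminf (\<lambda>j. ennreal ((cmod (f j x - f k x))\<^sup>2)) \<partial>UI)"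
    proof (rule nn_integral_cong_AE)
      show "AE x in UI. ennreal ((cmod (g x - f k x))\<^sup>2)
          = liminf (\<lambda>j. ennreal ((cmod (f j x - f k x))\<^sup>2))"
        using lim
      proof eventually_elim
        case (elim x)
        then have "(\<lambda>j. ennreal ((cmod (f j x - f k x))\<^sup>2)) \<longlonglongrightarrow> ennreal ((cmod (g x - f k x))\<^sup>2)"
          unfolding g_def by (intro tendsto_intros tendsto_ennrealI) auto
        then show ?case by (intro lim_imp_Liminf[symmetric]) auto
      qed
    qed
    also have "\<dots> \<le> liminf (\<lambda>j. \<integral>\<^sup>+x. ennreal ((cmod (f j x - f k x))\<^sup>2) \<partial>UI)"
      by (rule nn_integral_liminf) measurable
    also have "\<dots> \<le> ennreal (((1/2) ^ k)\<^sup>2)"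
    proof (rule Liminf_le)
      show "\<forall>\<^sub>F j in sequentially. (\<integral>\<^sup>+x. ennreal ((cmod (f j x - f k x))\<^sup>2) \<partial>UI) \<le> ennreal (((1/2) ^ k)\<^sup>2)"
        using eventually_ge_at_top[of k]
      proof eventually_elim
        case (elim j)
        have "norm (abs_L2 (\<lambda>x. f j x - f k x)) = dist (X (r j)) (X (r k))"
          using f by (simp add: Xf dist_norm abs_L2_diff)
        also have "\<dots> \<le> (1/2) ^ k"
          using M[of k "r j" "r k"] rM[of k k] rM[of k j] elim by simp
        finally have "(norm (abs_L2 (\<lambda>x. f j x - f k x)))\<^sup>2 \<le> ((1/2) ^ k)\<^sup>2"
          by (intro power_mono) auto
        moreover have "(\<integral>\<^sup>+x. ennreal ((cmod (f j x - f k x))\<^sup>2) \<partial>UI)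
            = ennreal ((norm (abs_L2 (\<lambda>x. f j x - f k x)))\<^sup>2)"
          by (rule nn_integral_L2) (intro sq_integrable_diff f)
        ultimately show ?case by (simp add: ennreal_leI)
      qed
    qed auto
    finally show ?thesis .
  qed
  have gf: "sq_integrable (\<lambda>x. g x - f k x)" for k
    unfolding sq_integrable_def
  proof (intro conjI integrableI_nonneg)
    show "(\<integral>\<^sup>+x. ennreal ((cmod (g x - f k x))\<^sup>2) \<partial>UI) < \<infinity>"
      using fatou[of k] by (rule order.strict_trans1) simp
  qed (auto intro!: measurable_compose)
  have g: "sq_integrable g"
    using sq_integrable_add[OF gf[of 0] f[of 0]] by simp
  have "dist ((X \<circ> r) k) (abs_L2 g) \<le> (1/2) ^ k" for k
  proof -
    have "ennreal ((norm (abs_L2 (\<lambda>x. g x - f k x)))\<^sup>2) \<le> ennreal (((1/2) ^ k)\<^sup>2)"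
      using fatou[of k] by (simp add: nn_integral_L2[OF gf])
    then have "norm (abs_L2 (\<lambda>x. g x - f k x)) \<le> (1/2) ^ k"
      by (subst (asm) ennreal_le_iff) (auto dest: power2_le_imp_le)
    then show ?thesis
      using abs_L2_diff[OF g f, of k]
      by (simp add: Xf dist_norm norm_minus_commute[of "abs_L2 (f k)"])
  qed
  then have "(\<lambda>k. dist ((X \<circ> r) k) (abs_L2 g)) \<longlonglongrightarrow> 0"
    by (intro Lim_null_comparison[OF _ LIMSEQ_power_zero[of "1/2"]]) (auto simp: always_eventually)
  then have "(X \<circ> r) \<longlonglongrightarrow> abs_L2 g"
    by (simp only: tendsto_dist_iff[of "X \<circ> r"])
  then show "convergent X"
    using Cauchy_converges_subseq[OF C r] by (auto simp: convergent_def)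
qed

definition unitary_mat :: "nat \<Rightarrow> complex mat \<Rightarrow> bool" where
  "unitary_mat N A \<longleftrightarrow>
     A \<in> carrier_mat N N \<and> A * mat_adjoint A = 1\<^sub>m N \<and> mat_adjoint A * A = 1\<^sub>m N"

definition walsh_filter :: "nat \<Rightarrow> complex mat \<Rightarrow> nat \<Rightarrow> real \<Rightarrow> complex" where
  "walsh_filter N A i x =
     complex_of_real (sqrt (real N)) *
       (\<Sum>j<N. A $$ (i, j) * indicator {real j / real N ..< (real j + 1) / real N} x)"

definition times_mod_1 :: "nat \<Rightarrow> real \<Rightarrow> real" where
  "times_mod_1 N x = frac (real N * x)"

lemma times_mod_1_measurable [measurable]: "times_mod_1 N \<in> UI \<rightarrow>\<^sub>M UI"
proof (rule measurable_restrict_space2)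
  show "times_mod_1 N \<in> space UI \<rightarrow> {0..1}"
    by (auto simp: times_mod_1_def intro: less_imp_le[OF frac_lt_1])
  have "times_mod_1 N \<in> borel_measurable borel"
    unfolding times_mod_1_def frac_def by measurable
  then show "times_mod_1 N \<in> UI \<rightarrow>\<^sub>M lborel"
    by (auto intro: measurable_restrict_space1)
qed

lemma times_mod_1_preserving:
  assumes N: "N > 0"
  shows "distr UI UI (times_mod_1 N) = UI"
proof (rule measure_eqI)
  fix B assume B': "B \<in> sets (distr UI UI (times_mod_1 N))"
  then have B: "B \<in> sets UI" by simp
  then have Bb: "B \<in> sets borel" and B01: "B \<subseteq> {0..1}"
    by (auto simp: sets_restrict_space)
  define h :: "real \<Rightarrow> ennreal" where "h x = indicator (B \<inter> {0..<1}) x" for x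
  have hm [measurable]: "h \<in> borel_measurable borel"
    unfolding h_def using Bb by measurable
  have Rm [measurable]: "times_mod_1 N \<in> borel_measurable borel"
    unfolding times_mod_1_def frac_def by measurable
  have pieces: "indicator {0..<1} x * h (times_mod_1 N x) = (\<Sum>k<N. h (- real k + real N * x))"
    for x :: real
  proof (cases "x \<in> {0..<1}")
    case True
    define k0 where "k0 = nat \<lfloor>real N * x\<rfloor>"
    have fl: "\<lfloor>real N * x\<rfloor> = int k0" using True by (simp add: k0_def)
    have "real N * x < real N * 1" using True N by (intro mult_strict_left_mono) auto
    then have k0N: "k0 < N" using fl by linarith
    have fr: "times_mod_1 N x = - real k0 + real N * x"
      by (simp add: times_mod_1_def frac_def fl)
    have zero: "h (- real k + real N * x) = 0" if "k \<noteq> k0" for k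
    proof -
      have "- real k + real N * x \<notin> {0..<1}"
      proof
        assume "- real k + real N * x \<in> {0..<1}"
        then have "\<lfloor>real N * x\<rfloor> = int k" by (intro floor_unique) auto
        then show False using fl that by simp
      qed
      then show ?thesis by (auto simp: h_def)
    qed
    have "(\<Sum>k<N. h (- real k + real N * x)) = (\<Sum>k<N. if k = k0 then h (- real k0 + real N * x) else 0)"
      by (intro sum.cong refl) (metis zero)
    also have "\<dots> = h (times_mod_1 N x)" using k0N by (simp add: fr)
    finally show ?thesis using True by simp
  next
    case False
    have "- real k + real N * x \<notin> {0..<1}" if "k < N" for k
    proof (cases "x < 0")
      case True
      then have "real N * x < 0" using N by (simp add: mult_pos_neg)
      then show ?thesis by auto
    next
      case F: False
      then have "1 \<le> x" using False by auto
      then have "real N * 1 \<le> real N * x" using N by (intro mult_left_mono) auto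
      moreover have "real k + 1 \<le> real N" using that by linarith
      ultimately show ?thesis unfolding atLeastLessThan_iff by linarith
    qed
    then have "(\<Sum>k<N. h (- real k + real N * x)) = 0" by (auto simp: h_def)
    then show ?thesis using False by simp
  qed
  have aff: "ennreal (real N) * (\<integral>\<^sup>+x. h (t + real N * x) \<partial>lborel) = (\<integral>\<^sup>+x. h x \<partial>lborel)" for t
    using nn_integral_real_affine[OF hm, of "real N" t] N by simp
  have "emeasure (distr UI UI (times_mod_1 N)) B = emeasure UI (times_mod_1 N -` B \<inter> {0..1})"
    using B by (subst emeasure_distr) auto
  also have "\<dots> = emeasure lborel (times_mod_1 N -` B \<inter> {0..1})"
    by (subst emeasure_restrict_space) auto
  also have "\<dots> = (\<integral>\<^sup>+x. indicator (times_mod_1 N -` B \<inter> {0..1}) x \<partial>lborel)"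
    using measurable_sets[OF Rm Bb] by (subst nn_integral_indicator) auto
  also have "\<dots> = (\<integral>\<^sup>+x. indicator {0..<1} x * h (times_mod_1 N x) \<partial>lborel)"
  proof (rule nn_integral_cong_AE, use AE_lborel_singleton[of "1::real"] in eventually_elim)
    case (elim x)
    have "times_mod_1 N x \<in> {0..<1}" by (auto simp: times_mod_1_def frac_lt_1)
    then show ?case using elim by (auto simp: h_def indicator_def)
  qed
  also have "\<dots> = (\<Sum>k<N. \<integral>\<^sup>+x. h (- real k + real N * x) \<partial>lborel)"
    unfolding pieces by (rule nn_integral_sum) measurable
  also have "\<dots> = (\<integral>\<^sup>+x. h x \<partial>lborel)"
  proof -
    define c where "c = (\<integral>\<^sup>+x. h (0 + real N * x) \<partial>lborel)"
    have nz: "ennreal (real N) \<noteq> 0" "ennreal (real N) < \<infinity>" using N by auto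
    have "(\<integral>\<^sup>+x. h (- real k + real N * x) \<partial>lborel) = c" for k
      using aff[of "- real k"] aff[of 0] nz unfolding c_def
      by (metis ennreal_mult_cancel_left less_irrefl infinity_ennreal_def)
    then have "(\<Sum>k<N. \<integral>\<^sup>+x. h (- real k + real N * x) \<partial>lborel) = of_nat N * c" by simp
    also have "\<dots> = (\<integral>\<^sup>+x. h x \<partial>lborel)"
      using aff[of 0] by (simp add: c_def ennreal_of_nat_eq_real_of_nat)
    finally show ?thesis .
  qed
  also have "\<dots> = (\<integral>\<^sup>+x. indicator B x \<partial>lborel)"
  proof (rule nn_integral_cong_AE, use AE_lborel_singleton[of "1::real"] in eventually_elim)
    case (elim x)
    then show ?case using B01 by (auto simp: h_def indicator_def)
  qed
  also have "\<dots> = emeasure lborel B" using Bb by simp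
  also have "\<dots> = emeasure UI B" using B01 Bb by (subst emeasure_restrict_space) auto
  finally show "emeasure (distr UI UI (times_mod_1 N)) B = emeasure UI B" .
qed simp

lemma walsh_filter_measurable [measurable]: "walsh_filter N A i \<in> borel_measurable UI"
proof -
  have "walsh_filter N A i \<in> borel_measurable lborel"
    unfolding walsh_filter_def by measurable
  then show ?thesis by (rule measurable_restrict_space1)
qed

lemma walsh_filter_bounded:
  "cmod (walsh_filter N A i x) \<le> sqrt (real N) * (\<Sum>j<N. cmod (A $$ (i, j)))"
proof -
  have "cmod (A $$ (i, j) * indicator S x) \<le> cmod (A $$ (i, j))" for j and S :: "real set"
    by (simp add: indicator_def)
  then have "cmod (\<Sum>j<N. A $$ (i, j) * indicator {real j / real N ..< (real j + 1) / real N} x)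
      \<le> (\<Sum>j<N. cmod (A $$ (i, j)))"
    by (intro sum_norm_le) auto
  then show ?thesis unfolding walsh_filter_def by (simp add: norm_mult mult_left_mono)
qed

lift_definition walsh_op :: "nat \<Rightarrow> complex mat \<Rightarrow> nat \<Rightarrow> L2 \<Rightarrow> L2" is
  "\<lambda>N A i f x. walsh_filter N A i x * f (times_mod_1 N x)"
proof -
  fix N :: nat and A :: "complex mat" and i :: nat and f g :: "real \<Rightarrow> complex"
  assume fg: "sq_integrable f \<and> sq_integrable g \<and> (AE x in UI. f x = g x)"
  show "sq_integrable (\<lambda>x. walsh_filter N A i x * f (times_mod_1 N x)) \<and>
    sq_integrable (\<lambda>x. walsh_filter N A i x * g (times_mod_1 N x)) \<and>
    (AE x in UI. walsh_filter N A i x * f (times_mod_1 N x) = walsh_filter N A i x * g (times_mod_1 N x))"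
  proof (cases "N = 0")
    case True
    then show ?thesis by (simp add: walsh_filter_def sq_integrable_const)
  next
    case False
    then have pres: "distr UI UI (times_mod_1 N) = UI" by (intro times_mod_1_preserving) simp
    have si: "sq_integrable (\<lambda>x. walsh_filter N A i x * h (times_mod_1 N x))"
      if h: "sq_integrable h" for h
      unfolding sq_integrable_def
    proof (intro conjI)
      have hm [measurable]: "h \<in> borel_measurable UI" using h by (simp add: sq_integrable_def)
      show "(\<lambda>x. walsh_filter N A i x * h (times_mod_1 N x)) \<in> borel_measurable UI" by measurable
      have "integrable (distr UI UI (times_mod_1 N)) (\<lambda>x. (cmod (h x))\<^sup>2)"
        using h by (simp add: pres sq_integrable_def)
      then have int: "integrable UI (\<lambda>x. (cmod (h (times_mod_1 N x)))\<^sup>2)"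
        by (subst (asm) integrable_distr_eq) auto
      define B where "B = sqrt (real N) * (\<Sum>j<N. cmod (A $$ (i, j)))"
      have "cmod (walsh_filter N A i x) \<le> B" for x unfolding B_def by (rule walsh_filter_bounded)
      then have "(cmod (walsh_filter N A i x))\<^sup>2 \<le> B\<^sup>2" for x by (intro power_mono) auto
      then have le: "(cmod (walsh_filter N A i x * h (times_mod_1 N x)))\<^sup>2
          \<le> B\<^sup>2 * (cmod (h (times_mod_1 N x)))\<^sup>2" for x
        by (simp add: norm_mult power_mult_distrib mult_right_mono)
      show "integrable UI (\<lambda>x. (cmod (walsh_filter N A i x * h (times_mod_1 N x)))\<^sup>2)"
      proof (rule Bochner_Integration.integrable_bound)
        show "integrable UI (\<lambda>x. B\<^sup>2 * (cmod (h (times_mod_1 N x)))\<^sup>2)" using int by simp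
        show "AE x in UI. norm ((cmod (walsh_filter N A i x * h (times_mod_1 N x)))\<^sup>2)
            \<le> norm (B\<^sup>2 * (cmod (h (times_mod_1 N x)))\<^sup>2)"
          using le by (intro AE_I2) simp
      qed measurable
    qed
    have "AE x in distr UI UI (times_mod_1 N). f x = g x" using fg unfolding pres by simp
    then have "AE x in UI. f (times_mod_1 N x) = g (times_mod_1 N x)"
      by (rule AE_distrD[OF times_mod_1_measurable])
    then show ?thesis using fg si by auto
  qed
qed

lift_definition one_L2 :: L2 is "\<lambda>x. 1"
  by (simp add: sq_integrable_const)

text \<open>
  The last letter is required to be nonzero.  For \<open>N = 2\<close> this says that the word ends in \<open>1\<close>;
  for \<open>N > 2\<close> all letters \<open>1, \<dots>, N - 1\<close> must be admitted, since the basis has to contain \<open>S\<^sub>l 1\<close>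
  for each \<open>l \<noteq> 0\<close>.
\<close>

definition basis_words :: "nat \<Rightarrow> nat list set" where
  "basis_words N = {w. set w \<subseteq> {..<N} \<and> (w = [] \<or> last w \<noteq> 0)}"

definition append_zeros :: "nat list \<Rightarrow> nat \<Rightarrow> nat" where
  "append_zeros w k = (if k < length w then w ! k else 0)"

end

theory Submission
  imports Defs
begin

text \<open>
  Two facts about the operators \<open>S\<^sub>i\<close> carry everything: they form a Cuntz family whose first isometry
  fixes the constant function \<open>1\<close> (the first row of the matrix makes \<open>m\<^sub>0 = 1\<close>), and the vectors
  \<open>S\<^sub>w 1\<close> span a dense subspace of \<open>L2\<close>.  The rest is bookkeeping with words, valid for
  every Cuntz family with such a vector \<open>v\<close>.

  The bookkeeping rests on one remark.  Because \<open>S\<^sub>0 v = v\<close>, a word and the same word with zeros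
  appended give the same vector, so that the vectors \<open>S\<^sub>w v\<close> are really labelled by infinite words
  ending in zeros; the words with nonzero last letter (and the empty word) are the canonical
  representatives.  In this labelling \<open>S\<^sub>j\<close> prefixes the letter \<open>j\<close>, and its adjoint deletes the
  first letter if that is \<open>j\<close> and annihilates the vector otherwise (\<open>S_e\<close>, \<open>Sa_e\<close>).  Orthonormality, the
  maps \<open>\<sigma>\<^sub>j\<close> and the encoding are read off from this.  The operator \<open>S\<^sub>w S\<^sub>w\<^sup>*\<close> is then the
  projection onto the basis vectors whose label begins with \<open>w\<close>, so sending a set of
  infinite words to the projection onto the basis vectors labelled in it is the projection valued
  measure of the representation, with one-dimensional atoms exactly at the labels.

  Irreducibility and the claim on finite dimensional subspaces have a common source,
  \<open>coinvariant_contains_v\<close>: the powers of \<open>S\<^sub>0\<^sup>*\<close> converge strongly to the rank-one projection onto \<open>v\<close>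
  (\<open>Sa_power_tendsto\<close>), so a nonzero closed subspace invariant under all adjoints contains \<open>v\<close>.  A finite
  dimensional subspace is closed; and if the subspace is invariant under the \<open>S\<^sub>i\<close> as well, it then
  contains all \<open>S\<^sub>w v\<close> and is everything.

  For the concrete operators, the adjoint is obtained by splitting an integral into the \<open>N\<close> pieces
  of the unit interval and rescaling (\<open>walsh_adj_cinner\<close>); the Cuntz relations are then the orthonormality
  of the rows and of the columns of the matrix.  For density, let \<open>D\<close> be a closed subspace
  containing \<open>1\<close> and invariant under all \<open>S\<^sub>i\<close>.  Inverting the matrix shows that \<open>D\<close> is
  invariant under copying a function, rescaled, into a single piece.  Hence \<open>D\<close> contains the indicators of
  segments with \<open>N\<close>-adic ends, then those of all segments, of all Borel sets, and finally every
  function (\<open>walsh_invariant_eq_UNIV\<close>).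
\<close>

section \<open>Complex inner product spaces\<close>

interpretation complex_vector: vector_space "scaleC :: complex \<Rightarrow> 'a \<Rightarrow> 'a::complex_inner"
  by (rule vector_space_scaleC)

lemma cinner_add_right: "cinner x (y + z) = cinner x y + cinner x (z :: 'a::complex_inner)"
  by (metis cinner_add_left cinner_commute complex_cnj_add)

lemma cinner_scaleC_right: "cinner x (c *\<^sub>C y) = cnj c * cinner x (y :: 'a::complex_inner)"
  by (metis cinner_commute cinner_scaleC_left complex_cnj_mult)

lemma cinner_zero_left [simp]: "cinner 0 (y :: 'a::complex_inner) = 0"
  using cinner_add_left[of 0 0 y] by simp

lemma cinner_zero_right [simp]: "cinner (y :: 'a::complex_inner) 0 = 0"
  using cinner_add_right[of y 0 0] by simp

lemma cinner_diff_left: "cinner (x - y) z = cinner x z - cinner y (z :: 'a::complex_inner)"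
  using cinner_add_left[of "x - y" y z] by simp

lemma cinner_diff_right: "cinner z (x - y) = cinner z x - cinner z (y :: 'a::complex_inner)"
  using cinner_add_right[of z "x - y" y] by simp

lemma cinner_sum_left: "cinner (\<Sum>i\<in>F. f i) (z :: 'a::complex_inner) = (\<Sum>i\<in>F. cinner (f i) z)"
  by (induction F rule: infinite_finite_induct) (auto simp: cinner_add_left)

lemma cinner_self: "cinner x (x :: 'a::complex_inner) = complex_of_real ((norm x)\<^sup>2)"
proof -
  have "Im (cinner x x) = 0"
    using arg_cong[OF cinner_commute[of x x], of Im] by simp
  moreover have "Re (cinner x x) = (norm x)\<^sup>2"
    by (simp add: power2_norm_eq_inner inner_eq_Re_cinner)
  ultimately show ?thesis by (simp add: complex_eq_iff)
qed

lemma cinner_self_eq_0_iff [simp]: "cinner x x = 0 \<longleftrightarrow> x = (0 :: 'a::complex_inner)"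
  by (simp add: cinner_self)

lemma cinner_eqI: "(\<And>z. cinner x z = cinner y z) \<Longrightarrow> x = (y :: 'a::complex_inner)"
  by (metis cinner_diff_left cinner_self_eq_0_iff eq_iff_diff_eq_0)

lemma norm_scaleC: "norm (c *\<^sub>C x) = cmod c * norm (x :: 'a::complex_inner)"
proof -
  have "c * cnj c = complex_of_real ((cmod c)\<^sup>2)" using complex_norm_square[of c] by simp
  then have "complex_of_real ((norm (c *\<^sub>C x))\<^sup>2) = complex_of_real ((cmod c * norm x)\<^sup>2)"
    unfolding cinner_self[symmetric] cinner_scaleC_left cinner_scaleC_right
    by (simp add: cinner_self power_mult_distrib mult.assoc[symmetric] mult.commute[of "cnj c"])
  then have "(norm (c *\<^sub>C x))\<^sup>2 = (cmod c * norm x)\<^sup>2" by (simp only: of_real_eq_iff)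
  then show ?thesis by (rule power2_eq_imp_eq) auto
qed

text \<open>Rotating one argument makes the complex inner product real, where the real bound applies.\<close>

lemma cinner_Cauchy_Schwarz: "cmod (cinner x y) \<le> norm x * norm (y :: 'a::complex_inner)"
proof (cases "cinner x y = 0")
  case False
  define c where "c = cnj (cinner x y) / cmod (cinner x y)"
  have c: "cmod c = 1" using False by (simp add: c_def norm_divide)
  have "cinner (c *\<^sub>C x) y = complex_of_real (cmod (cinner x y))"
    using False complex_norm_square[of "cinner x y"]
    by (simp add: c_def cinner_scaleC_left field_simps power2_eq_square)
  then have "cmod (cinner x y) = inner (c *\<^sub>C x) y" by (simp add: inner_eq_Re_cinner)
  also have "\<dots> \<le> norm (c *\<^sub>C x) * norm y" by (rule norm_cauchy_schwarz)
  finally show ?thesis by (simp add: norm_scaleC c)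
qed simp

lemma bounded_linear_cinner_left: "bounded_linear (\<lambda>x :: 'a::complex_inner. cinner x y)"
  by (rule bounded_linear_intro[where K = "norm y"])
    (auto simp: cinner_add_left scaleR_scaleC cinner_scaleC_left scaleR_conv_of_real cinner_Cauchy_Schwarz)

lemma bounded_linear_scaleC_right: "bounded_linear (\<lambda>x :: 'a::complex_inner. c *\<^sub>C x)"
  by (rule bounded_linear_intro[where K = "cmod c"])
    (auto simp: scaleR_scaleC scaleC_add_right scaleC_scaleC norm_scaleC mult.commute)

lemma norm_add_orthogonal:
  assumes "cinner x y = (0 :: complex)"
  shows "(norm (x + y :: 'a::complex_inner))\<^sup>2 = (norm x)\<^sup>2 + (norm y)\<^sup>2"
proof -
  have "inner x y = 0" using assms by (simp add: inner_eq_Re_cinner)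
  then show ?thesis by (simp add: power2_norm_eq_inner inner_add inner_commute)
qed

text \<open>
  An operator with a formal adjoint is determined by inner products, which are linear in the
  argument of the operator.  So linearity comes for free, and the adjoint is unique.
\<close>

context
  fixes T T' :: "'a::complex_inner \<Rightarrow> 'a"
  assumes adj: "\<And>x y. cinner (T x) y = cinner x (T' y)"
begin

lemma adjoint_pair_add: "T (x + y) = T x + T y"
  by (rule cinner_eqI) (simp add: adj cinner_add_left)

lemma adjoint_pair_scaleC: "T (c *\<^sub>C x) = c *\<^sub>C T x"
  by (rule cinner_eqI) (simp add: adj cinner_scaleC_left)

lemma adjoint_pair_swap: "cinner (T' x) y = cinner x (T y)"
  by (metis adj cinner_commute)

lemma cadjoint_eqI: "cadjoint T = T'"
  unfolding cadjoint_def
proof (rule the_equality)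
  show "T'' = T'" if "\<forall>x y. cinner (T x) y = cinner x (T'' y)" for T''
  proof
    fix y
    show "T'' y = T' y"
      by (rule cinner_eqI) (metis that adj cinner_commute)
  qed
qed (simp add: adj)

lemma adjoint_pair_bounded:
  assumes "\<And>x. norm (T x) \<le> norm x"
  shows "bounded_clinear T"
  unfolding bounded_clinear_def
  using assms
  by (auto intro!: bounded_linear_intro[where K = 1] simp: adjoint_pair_add adjoint_pair_scaleC scaleR_scaleC)

end

text \<open>
  Self-adjointness gives linearity; boundedness is the Pythagorean theorem for \<open>x = Q x + (x - Q x)\<close>.
\<close>

lemma is_projectionI:
  assumes sa: "\<And>x y. cinner (Q x) y = cinner x (Q y)"
    and idem: "\<And>x. Q (Q x) = Q (x :: 'a::complex_inner)"
  shows "is_projection Q"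
proof -
  have "norm (Q x) \<le> norm x" for x
  proof -
    have "cinner (Q x) (x - Q x) = 0" by (simp add: cinner_diff_right sa idem)
    then have "(norm x)\<^sup>2 = (norm (Q x))\<^sup>2 + (norm (x - Q x))\<^sup>2"
      using norm_add_orthogonal[of "Q x" "x - Q x"] by simp
    then have "(norm (Q x))\<^sup>2 \<le> (norm x)\<^sup>2" by simp
    then show ?thesis by (rule power2_le_imp_le) simp
  qed
  then have "bounded_clinear Q" using sa by (intro adjoint_pair_bounded[of Q Q])
  then show ?thesis using sa idem by (simp add: is_projection_def fun_eq_iff)
qed

lemma csubspace_closure:
  assumes "csubspace (M :: 'a::complex_inner set)"
  shows "csubspace (closure M)"
proof (rule complex_vector.subspaceI)
  show "0 \<in> closure M"
    using assms closure_subset complex_vector.subspace_0 by blast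
  show "x + y \<in> closure M" if xy: "x \<in> closure M" "y \<in> closure M" for x y
  proof -
    obtain f g where "\<forall>n. f n \<in> M" "f \<longlonglongrightarrow> x" "\<forall>n. g n \<in> M" "g \<longlonglongrightarrow> y"
      using xy unfolding closure_sequential by blast
    then have "\<forall>n. f n + g n \<in> M" "(\<lambda>n. f n + g n) \<longlonglongrightarrow> x + y"
      using assms by (auto intro: complex_vector.subspace_add tendsto_add)
    then show ?thesis unfolding closure_sequential by (intro exI[of _ "\<lambda>n. f n + g n"] conjI)
  qed
  show "c *\<^sub>C x \<in> closure M" if x: "x \<in> closure M" for c x
  proof -
    obtain f where "\<forall>n. f n \<in> M" "f \<longlonglongrightarrow> x"
      using x unfolding closure_sequential by blast
    then have "\<forall>n. c *\<^sub>C f n \<in> M" "(\<lambda>n. c *\<^sub>C f n) \<longlonglongrightarrow> c *\<^sub>C x"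
      using assms
      by (auto intro: complex_vector.subspace_scale bounded_linear.tendsto[OF bounded_linear_scaleC_right])
    then show ?thesis unfolding closure_sequential by (intro exI[of _ "\<lambda>n. c *\<^sub>C f n"] conjI)
  qed
qed

lemma csubspace_closed_eq_UNIV:
  assumes "csubspace M" "closed M" "B \<subseteq> M" "closure (cspan B) = (UNIV :: 'a::complex_inner set)"
  shows "M = UNIV"
  using assms closure_minimal complex_vector.span_minimal by blast

text \<open>
  Gram-Schmidt in projection form: adding one vector to the spanning set adds one rank-one term to
  the orthogonal projection.  This is what makes finite dimensional subspaces closed.
\<close>

lemma finite_span_projection:
  assumes "finite B"
  shows "\<exists>Q. (\<forall>x :: 'a::complex_inner. Q x \<in> cspan B) \<and>
    (\<forall>x. \<forall>y\<in>cspan B. cinner (x - Q x) y = 0)"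
  using assms
proof (induction B rule: finite_induct)
  case empty
  show ?case by (rule exI[of _ "\<lambda>x. 0"]) auto
next
  case (insert a B)
  then obtain Q where Q: "\<And>x. Q x \<in> cspan B" "\<And>x y. y \<in> cspan B \<Longrightarrow> cinner (x - Q x) y = 0"
    by metis
  define b where "b = a - Q a"
  \<comment> \<open>If \<open>a\<close> already lies in the span, then \<open>b = 0\<close> and the correction vanishes.\<close>
  define Q' where "Q' x = Q x + (cinner x b / cinner b b) *\<^sub>C b" for x
  have sub: "cspan B \<subseteq> cspan (insert a B)" by (intro complex_vector.span_mono) auto
  have aB: "a \<in> cspan (insert a B)" by (simp add: complex_vector.span_base)
  have b: "b \<in> cspan (insert a B)"
    unfolding b_def using Q(1) sub aB by (auto intro: complex_vector.span_diff)
  have by0: "cinner b y = 0" "cinner y b = 0" if "y \<in> cspan B" for y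
    using Q(2)[OF that, of a] cinner_commute[of y b] by (auto simp: b_def)
  have "cinner (x - Q' x) y = 0" if y: "y \<in> cspan (insert a B)" for x y
  proof -
    obtain c where c: "y - c *\<^sub>C a \<in> cspan B"
      using y complex_vector.span_breakdown_eq by blast
    define z where "z = (y - c *\<^sub>C a) + c *\<^sub>C Q a"
    have z: "z \<in> cspan B"
      unfolding z_def using c Q(1) by (intro complex_vector.span_add complex_vector.span_scale)
    have yz: "y = z + c *\<^sub>C b"
      by (simp add: z_def b_def complex_vector.scale_right_diff_distrib)
    have xb: "cinner (x - Q x) b = cinner x b" using by0(2)[OF Q(1)] by (simp add: cinner_diff_left)
    have Q': "x - Q' x = (x - Q x) - (cinner x b / cinner b b) *\<^sub>C b" by (simp add: Q'_def)
    have "cinner (x - Q' x) z = 0" "cinner (x - Q' x) b = 0"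
      unfolding Q' cinner_diff_left[of "x - Q x"] cinner_scaleC_left Q(2)[OF z] by0[OF z] xb by auto
    then show ?thesis by (simp add: yz cinner_add_right cinner_scaleC_right)
  qed
  moreover have "Q' x \<in> cspan (insert a B)" for x
    unfolding Q'_def using Q(1) sub b by (auto intro: complex_vector.span_add complex_vector.span_scale)
  ultimately show ?case by blast
qed

text \<open>
  The residual of the limit is orthogonal to the subspace, hence by continuity to the limit itself,
  hence to itself.
\<close>

lemma finite_dim_closed:
  assumes "finite_dim (M :: 'a::complex_inner set)"
  shows "closed M"
proof -
  obtain B where B: "finite B" "M = cspan B" using assms by (auto simp: finite_dim_def)
  obtain Q where Q: "\<And>x. Q x \<in> M" "\<And>x y. y \<in> M \<Longrightarrow> cinner (x - Q x) y = 0"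
    using finite_span_projection[OF B(1)] B(2) by metis
  show ?thesis unfolding closed_sequential_limits
  proof (intro allI impI, elim conjE)
    fix f l assume f: "\<forall>n. f n \<in> M" and lim: "f \<longlonglongrightarrow> l"
    have orth: "cinner y (l - Q l) = 0" if "y \<in> M" for y
      using Q(2)[OF that, of l] cinner_commute[of y] by simp
    have "(\<lambda>n. cinner (f n) (l - Q l)) \<longlonglongrightarrow> cinner l (l - Q l)"
      by (rule bounded_linear.tendsto[OF bounded_linear_cinner_left lim])
    then have "cinner l (l - Q l) = 0"
      using f by (simp add: orth LIMSEQ_const_iff)
    then have "cinner (l - Q l) (l - Q l) = 0"
      using orth[OF Q(1)] by (simp add: cinner_diff_left)
    then show "l \<in> M" using Q(1)[of l] by simp
  qed
qed

section \<open>Coordinate projections of an orthonormal basis\<close>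

instance complex_hilbert \<subseteq> banach ..

context
  fixes \<Lambda> :: "'i set" and e :: "'i \<Rightarrow> 'a::complex_hilbert"
  assumes basis: "orthonormal_basis \<Lambda> e"
begin

lemma basis_cinner: "l \<in> \<Lambda> \<Longrightarrow> k \<in> \<Lambda> \<Longrightarrow> cinner (e l) (e k) = (if l = k then 1 else 0)"
  using basis by (simp add: orthonormal_basis_def)

lemma basis_inj: "inj_on e \<Lambda>"
  by (rule inj_onI) (metis basis_cinner zero_neq_one)

lemma basis_vanishing_coefficients:
  assumes "\<And>l. l \<in> \<Lambda> \<Longrightarrow> cinner x (e l) = 0"
  shows "x = 0"
proof -
  have "{y. cinner y x = 0} = UNIV"
  proof (rule csubspace_closed_eq_UNIV)
    show "csubspace {y. cinner y x = 0}"
      by (auto intro!: complex_vector.subspaceI simp: cinner_add_left cinner_scaleC_left)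
    show "closed {y. cinner y x = 0}"
      by (intro closed_Collect_eq continuous_on_const
          linear_continuous_on bounded_linear_cinner_left)
    show "e ` \<Lambda> \<subseteq> {y. cinner y x = 0}"
    proof
      fix y assume "y \<in> e ` \<Lambda>"
      then show "y \<in> {y. cinner y x = 0}" using assms cinner_commute[of y x] by auto
    qed
    show "closure (cspan (e ` \<Lambda>)) = UNIV" using basis by (simp add: orthonormal_basis_def)
  qed
  then show ?thesis using cinner_self_eq_0_iff by blast
qed

lemma basis_eqI: "(\<And>l. l \<in> \<Lambda> \<Longrightarrow> cinner x (e l) = cinner y (e l)) \<Longrightarrow> x = y"
  using basis_vanishing_coefficients[of "x - y"] by (simp add: cinner_diff_left)

text \<open>
  A Fourier partial sum over a finite index set is the best approximation from the span, so
  density of the span forces the net of partial sums to converge.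
\<close>

lemma basis_expansion: "((\<lambda>l. cinner x (e l) *\<^sub>C e l) has_sum x) \<Lambda>"
proof -
  define s where "s F = (\<Sum>l\<in>F. cinner x (e l) *\<^sub>C e l)" for F
  have best: "norm (x - s F) \<le> norm (x - z)"
    if F: "finite F" "F \<subseteq> \<Lambda>" and z: "z \<in> cspan (e ` F)" for F z
  proof -
    have "cinner (s F) (e k) = cinner x (e k)" if "k \<in> F" for k
    proof -
      have "cinner (s F) (e k) = (\<Sum>l\<in>F. if l = k then cinner x (e l) else 0)"
        unfolding s_def cinner_sum_left cinner_scaleC_left
        using F that by (intro sum.cong) (auto simp: basis_cinner subset_iff)
      then show ?thesis using F that by simp
    qed
    then have "e ` F \<subseteq> {y. cinner (x - s F) y = 0}" by (auto simp: cinner_diff_left)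
    moreover have "csubspace {y. cinner (x - s F) y = 0}"
      by (auto intro!: complex_vector.subspaceI simp: cinner_add_right cinner_scaleC_right)
    ultimately have orth: "cspan (e ` F) \<subseteq> {y. cinner (x - s F) y = 0}"
      by (rule complex_vector.span_minimal)
    have "s F - z \<in> cspan (e ` F)"
      unfolding s_def
      by (intro complex_vector.span_diff complex_vector.span_sum complex_vector.span_scale z)
        (auto intro: complex_vector.span_base)
    then have "cinner (x - s F) (s F - z) = 0" using orth by blast
    from norm_add_orthogonal[OF this] have "(norm (x - s F))\<^sup>2 \<le> (norm (x - z))\<^sup>2" by simp
    then show ?thesis by (rule power2_le_imp_le) simp
  qed
  have "(s \<longlongrightarrow> x) (finite_subsets_at_top \<Lambda>)"
  proof (rule tendstoI)
    fix \<epsilon> :: real assume "\<epsilon> > 0"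
    moreover have "x \<in> closure (cspan (e ` \<Lambda>))" using basis by (simp add: orthonormal_basis_def)
    ultimately obtain z where z: "z \<in> cspan (e ` \<Lambda>)" "dist z x < \<epsilon>"
      by (auto simp: closure_approachable)
    obtain t r where t: "finite t" "t \<subseteq> e ` \<Lambda>" "z = (\<Sum>a\<in>t. r a *\<^sub>C a)"
      using z(1) unfolding complex_vector.span_explicit by auto
    obtain F0 where F0: "F0 \<subseteq> \<Lambda>" "finite F0" "t = e ` F0"
      using finite_subset_image[OF t(1,2)] by metis
    have zF: "z \<in> cspan (e ` F)" if "F0 \<subseteq> F" for F
      unfolding t(3) using F0(3) that
      by (intro complex_vector.span_sum complex_vector.span_scale complex_vector.span_base) auto
    show "\<forall>\<^sub>F F in finite_subsets_at_top \<Lambda>. dist (s F) x < \<epsilon>"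
      unfolding eventually_finite_subsets_at_top
    proof (intro exI[of _ F0] conjI allI impI)
      fix F assume "finite F \<and> F0 \<subseteq> F \<and> F \<subseteq> \<Lambda>"
      then have "norm (x - s F) \<le> norm (x - z)" using best zF by blast
      then show "dist (s F) x < \<epsilon>" using z(2) by (simp add: dist_norm norm_minus_commute)
    qed (use F0 in auto)
  qed
  then show ?thesis by (simp add: has_sum_def s_def[abs_def])
qed

definition coord_proj :: "'i set \<Rightarrow> 'a \<Rightarrow> 'a" where
  "coord_proj C x = (\<Sum>\<^sub>\<infinity>l\<in>C. cinner x (e l) *\<^sub>C e l)"

lemma coord_proj_has_sum:
  assumes C: "C \<subseteq> \<Lambda>"
  shows "((\<lambda>l. cinner x (e l) *\<^sub>C e l) has_sum coord_proj C x) C"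
proof -
  have "(\<lambda>l. cinner x (e l) *\<^sub>C e l) summable_on C"
    using has_sum_imp_summable[OF basis_expansion] C by (rule summable_on_subset_banach)
  then show ?thesis unfolding coord_proj_def by (rule has_sum_infsum)
qed

lemma coord_proj_cinner:
  assumes C: "C \<subseteq> \<Lambda>"
  shows "((\<lambda>l. cinner x (e l) * cinner (e l) y) has_sum cinner (coord_proj C x) y) C"
  using has_sum_bounded_linear[OF bounded_linear_cinner_left coord_proj_has_sum[OF C]]
  by (simp add: cinner_scaleC_left)

lemma coord_proj_selfadjoint:
  assumes C: "C \<subseteq> \<Lambda>"
  shows "cinner (coord_proj C x) y = cinner x (coord_proj C y)"
proof -
  have "((\<lambda>l. cnj (cinner y (e l) * cinner (e l) x)) has_sum cnj (cinner (coord_proj C y) x)) C"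
    unfolding has_sum_cnj_iff by (rule coord_proj_cinner[OF C])
  then have "((\<lambda>l. cinner x (e l) * cinner (e l) y) has_sum cinner x (coord_proj C y)) C"
    by (simp add: cinner_commute[symmetric] mult.commute)
  then show ?thesis using coord_proj_cinner[OF C] has_sum_unique by blast
qed

lemma coord_proj_coefficient:
  assumes C: "C \<subseteq> \<Lambda>" and k: "k \<in> \<Lambda>"
  shows "cinner (coord_proj C x) (e k) = (if k \<in> C then cinner x (e k) else 0)"
proof -
  have "((\<lambda>l. if l = k then cinner x (e k) else 0) has_sum cinner (coord_proj C x) (e k)) C"
    using coord_proj_cinner[OF C, of x "e k"] C k
    by (subst has_sum_cong[where g = "\<lambda>l. cinner x (e l) * cinner (e l) (e k)"])
      (auto simp: basis_cinner subset_iff)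
  moreover have "((\<lambda>l. if l = k then cinner x (e k) else 0) has_sum (if k \<in> C then cinner x (e k) else 0)) C"
    using has_sum_finite[of "C \<inter> {k}" "\<lambda>l. if l = k then cinner x (e k) else 0"]
    by (subst has_sum_cong_neutral[where T = "C \<inter> {k}" and g = "\<lambda>l. if l = k then cinner x (e k) else 0"]) auto
  ultimately show ?thesis by (rule has_sum_unique)
qed

lemma coord_proj_Int:
  assumes "C \<subseteq> \<Lambda>" "D \<subseteq> \<Lambda>"
  shows "coord_proj C (coord_proj D x) = coord_proj (C \<inter> D) x"
proof -
  have "C \<inter> D \<subseteq> \<Lambda>" using assms by blast
  then show ?thesis using assms by (intro basis_eqI) (auto simp: coord_proj_coefficient)
qed

lemma coord_proj_is_projection: "C \<subseteq> \<Lambda> \<Longrightarrow> is_projection (coord_proj C)"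
  by (rule is_projectionI) (simp_all add: coord_proj_selfadjoint coord_proj_Int)

lemma coord_proj_all: "coord_proj \<Lambda> x = x"
  by (rule basis_eqI) (auto simp: coord_proj_coefficient)

lemma coord_proj_singleton: "coord_proj {l} x = cinner x (e l) *\<^sub>C e l"
  by (simp add: coord_proj_def)

text \<open>
  The unconditional sum over the union is summed first over each member of the family.
\<close>

lemma coord_proj_sums:
  fixes C :: "nat \<Rightarrow> 'i set"
  assumes C: "\<And>n. C n \<subseteq> \<Lambda>" and disj: "disjoint_family C"
  shows "(\<lambda>n. coord_proj (C n) x) sums coord_proj (\<Union>n. C n) x"
proof -
  define f where "f l = cinner x (e l) *\<^sub>C e l" for l
  have inj: "inj_on snd (Sigma UNIV C)"
  proof (rule inj_onI)
    fix p q assume pq: "p \<in> Sigma UNIV C" "q \<in> Sigma UNIV C" "snd p = snd q"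
    then have "snd p \<in> C (fst p) \<inter> C (fst q)" by auto
    then have "fst p = fst q" using disj by (auto simp: disjoint_family_on_def)
    then show "p = q" using pq(3) by (rule prod_eqI)
  qed
  have img: "snd ` Sigma UNIV C = (\<Union>n. C n)" by force
  have "(f has_sum coord_proj (\<Union>n. C n) x) (snd ` Sigma UNIV C)"
    unfolding img f_def using C by (intro coord_proj_has_sum) auto
  then have "((f \<circ> snd) has_sum coord_proj (\<Union>n. C n) x) (Sigma UNIV C)"
    by (simp add: has_sum_reindex[OF inj])
  then have "((\<lambda>n. coord_proj (C n) x) has_sum coord_proj (\<Union>n. C n) x) UNIV"
    by (rule has_sum_SigmaD) (use coord_proj_has_sum[OF C] in \<open>simp add: f_def\<close>)
  then show ?thesis by (rule has_sum_imp_sums)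
qed

text \<open>
  All projections involved are diagonal in the basis: multiplicativity is intersection of index
  sets, and countable additivity is a regrouping of the Fourier expansion.
\<close>

lemma labelled_basis_pvm:
  assumes "E ` \<Lambda> \<subseteq> space M"
  shows "is_pvm M (\<lambda>B. coord_proj {l \<in> \<Lambda>. E l \<in> B})"
proof -
  have all: "{l \<in> \<Lambda>. E l \<in> space M} = \<Lambda>" using assms by auto
  have Int: "coord_proj {l \<in> \<Lambda>. E l \<in> B \<inter> C} =
      coord_proj {l \<in> \<Lambda>. E l \<in> B} \<circ> coord_proj {l \<in> \<Lambda>. E l \<in> C}" for B C
  proof -
    have "{l \<in> \<Lambda>. E l \<in> B \<inter> C} = {l \<in> \<Lambda>. E l \<in> B} \<inter> {l \<in> \<Lambda>. E l \<in> C}" by auto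
    then show ?thesis by (auto simp: coord_proj_Int)
  qed
  have sums: "(\<lambda>n. coord_proj {l \<in> \<Lambda>. E l \<in> B n} x) sums coord_proj {l \<in> \<Lambda>. E l \<in> (\<Union>n. B n)} x"
    if "disjoint_family B" for B :: "nat \<Rightarrow> _" and x
  proof -
    have "{l \<in> \<Lambda>. E l \<in> (\<Union>n. B n)} = (\<Union>n. {l \<in> \<Lambda>. E l \<in> B n})" by auto
    moreover have "disjoint_family (\<lambda>n. {l \<in> \<Lambda>. E l \<in> B n})"
      using that by (auto simp: disjoint_family_on_def)
    ultimately show ?thesis by (simp only:) (rule coord_proj_sums, auto)
  qed
  show ?thesis
    unfolding is_pvm_def
  proof (intro conjI ballI allI impI)
    show "coord_proj {l \<in> \<Lambda>. E l \<in> {}} = (\<lambda>x. 0)" by (simp add: coord_proj_def fun_eq_iff)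
    show "coord_proj {l \<in> \<Lambda>. E l \<in> space M} = id" by (auto simp: all coord_proj_all)
    show "coord_proj {l \<in> \<Lambda>. E l \<in> B \<inter> C} =
        coord_proj {l \<in> \<Lambda>. E l \<in> B} \<circ> coord_proj {l \<in> \<Lambda>. E l \<in> C}" for B C
      by (rule Int)
  qed (use sums in \<open>auto intro!: coord_proj_is_projection\<close>)
qed

end

section \<open>Cuntz families\<close>

lemma word_op_Nil [simp]: "word_op S [] x = x"
  by (simp add: word_op_def)

lemma word_op_Cons [simp]: "word_op S (i # w) x = S i (word_op S w x)"
  by (simp add: word_op_def)

text \<open>
  The adjoints are carried as explicit operators, so that every later computation happens inside
  inner products.  The adjoint of \<open>word_op S w\<close> is then \<open>fold Sa w\<close>, since \<open>fold\<close> applies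
  the first letter first.
\<close>

locale cuntz_pair =
  fixes N :: nat and S Sa :: "nat \<Rightarrow> 'a::complex_hilbert \<Rightarrow> 'a"
  assumes adj: "i < N \<Longrightarrow> cinner (S i x) y = cinner x (Sa i y)"
    and rel: "i < N \<Longrightarrow> j < N \<Longrightarrow> Sa i (S j x) = (if i = j then x else 0)"
    and complete: "(\<Sum>i<N. S i (Sa i x)) = x"
begin

lemma adj': "i < N \<Longrightarrow> cinner (Sa i x) y = cinner x (S i y)"
  by (rule adjoint_pair_swap[of "S i"]) (rule adj)

lemma S_zero [simp]: "i < N \<Longrightarrow> S i 0 = 0"
  using adjoint_pair_scaleC[of "S i" "Sa i" 0 0] adj by simp

lemma Sa_zero [simp]: "i < N \<Longrightarrow> Sa i 0 = 0"
  using adjoint_pair_scaleC[of "Sa i" "S i" 0 0] adj' by simp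

lemma norm_S: "i < N \<Longrightarrow> norm (S i x) = norm x"
proof -
  assume i: "i < N"
  have "complex_of_real ((norm (S i x))\<^sup>2) = complex_of_real ((norm x)\<^sup>2)"
    unfolding cinner_self[symmetric] adj[OF i] rel[OF i i] by simp
  then have "(norm (S i x))\<^sup>2 = (norm x)\<^sup>2" by (simp only: of_real_eq_iff)
  then show ?thesis by (rule power2_eq_imp_eq) auto
qed

lemma norm_Sa_le: "i < N \<Longrightarrow> norm (Sa i x) \<le> norm x"
proof -
  assume i: "i < N"
  have "complex_of_real ((norm (Sa i x))\<^sup>2) = cinner (S i (Sa i x)) x"
    unfolding cinner_self[symmetric] adj[OF i] ..
  then have "(norm (Sa i x))\<^sup>2 = cmod (cinner (S i (Sa i x)) x)"
    by (metis norm_of_real abs_power2)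
  also have "\<dots> \<le> norm (Sa i x) * norm x"
    using cinner_Cauchy_Schwarz[of "S i (Sa i x)" x] by (simp add: norm_S i)
  finally show ?thesis
    by (cases "norm (Sa i x) = 0") (auto simp: power2_eq_square mult_le_cancel_left)
qed

lemma cadjoint_S: "i < N \<Longrightarrow> cadjoint (S i) = Sa i"
  by (rule cadjoint_eqI) (rule adj)

lemma bounded_clinear_S: "i < N \<Longrightarrow> bounded_clinear (S i)"
  by (rule adjoint_pair_bounded[of "S i" "Sa i"]) (simp_all add: adj norm_S)

lemma cuntz_rep: "cuntz_rep N S"
  unfolding cuntz_rep_def
proof (intro conjI allI impI)
  fix x
  have "(\<Sum>i<N. S i (cadjoint (S i) x)) = (\<Sum>i<N. S i (Sa i x))"
    by (intro sum.cong refl) (simp add: cadjoint_S)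
  then show "(\<Sum>i<N. S i (cadjoint (S i) x)) = x" by (simp only: complete)
qed (simp_all add: bounded_clinear_S cadjoint_S rel)

lemma word_adj:
  "set w \<subseteq> {..<N} \<Longrightarrow> cinner (word_op S w x) y = cinner x (fold Sa w y)"
  by (induction w arbitrary: y) (auto simp: adj)

lemma Sa_power_adj: "i < N \<Longrightarrow> cinner ((Sa i ^^ n) x) y = cinner x ((S i ^^ n) y)"
  by (induction n arbitrary: y) (auto simp: adj' simp flip: funpow_swap1)

lemma norm_Sa_power_le: "i < N \<Longrightarrow> norm ((Sa i ^^ n) x) \<le> norm x"
  by (induction n) (auto intro: order_trans[OF norm_Sa_le])

end

section \<open>Words with last letter nonzero\<close>

text \<open>Prefixing a letter to the infinite word \<open>w000\<dots>\<close>, in terms of the shortest \<open>w\<close> representing it.\<close>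

definition cons_word :: "nat \<Rightarrow> nat list \<Rightarrow> nat list" where
  "cons_word j w = (if j = 0 \<and> w = [] then [] else j # w)"

lemma word_op_cons_word:
  "S 0 v = v \<Longrightarrow> S j (word_op S w v) = word_op S (cons_word j w) v"
  by (auto simp: cons_word_def)

lemma Nil_in_basis_words [simp]: "[] \<in> basis_words N"
  by (simp add: basis_words_def)

lemma cons_word_in_basis_words: "j < N \<Longrightarrow> w \<in> basis_words N \<Longrightarrow> cons_word j w \<in> basis_words N"
  by (auto simp: basis_words_def cons_word_def)

lemma drop_in_basis_words: "w \<in> basis_words N \<Longrightarrow> drop k w \<in> basis_words N"
  by (cases "k < length w") (auto simp: basis_words_def last_drop dest: in_set_dropD)

lemma tl_in_basis_words: "w \<in> basis_words N \<Longrightarrow> tl w \<in> basis_words N"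
  using drop_in_basis_words[of w N 1] by (simp add: drop_Suc)

lemma append_zeros_less: "0 < N \<Longrightarrow> w \<in> basis_words N \<Longrightarrow> append_zeros w k < N"
  by (auto simp: basis_words_def append_zeros_def subset_iff)

lemma append_zeros_Nil [simp]: "append_zeros [] k = 0"
  by (simp add: append_zeros_def)

lemma append_zeros_Cons_0 [simp]: "append_zeros (j # w) 0 = j"
  by (simp add: append_zeros_def)

lemma append_zeros_drop: "append_zeros (drop n w) k = append_zeros w (n + k)"
  by (auto simp: append_zeros_def)

lemma append_zeros_tl [simp]: "append_zeros (tl w) k = append_zeros w (Suc k)"
  using append_zeros_drop[of 1 w k] by (simp add: drop_Suc)

lemma append_zeros_cons_word: "append_zeros (cons_word j w) k = (case k of 0 \<Rightarrow> j | Suc i \<Rightarrow> append_zeros w i)"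
  by (auto simp: cons_word_def append_zeros_def split: nat.split)

lemma tl_cons_word [simp]: "tl (cons_word j w) = w"
  by (simp add: cons_word_def)

lemma cons_word_eq_iff:
  assumes "w \<in> basis_words N"
  shows "cons_word j u = w \<longleftrightarrow> j = append_zeros w 0 \<and> u = tl w"
  using assms by (cases w) (auto simp: cons_word_def basis_words_def)

text \<open>
  The length of a word with nonzero last letter can be recovered: it marks the last nonzero entry.
\<close>

lemma inj_append_zeros: "inj_on append_zeros (basis_words N)"
proof (rule inj_onI)
  have le: "length u \<le> length w"
    if "u \<in> basis_words N" "append_zeros w = append_zeros u" for u w
  proof (rule ccontr)
    assume less: "\<not> length u \<le> length w"
    then have "append_zeros u (length u - 1) = 0"
      by (subst that(2)[symmetric]) (auto simp: append_zeros_def)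
    with less that(1) show False
      using last_conv_nth[of u] by (fastforce simp: append_zeros_def basis_words_def split: if_splits)
  qed
  fix w u assume wu: "w \<in> basis_words N" "u \<in> basis_words N" "append_zeros w = append_zeros u"
  then have len: "length w = length u" using le by (metis order_antisym)
  show "w = u"
  proof (rule nth_equalityI[OF len])
    fix i assume "i < length w"
    then show "w ! i = u ! i"
      using fun_cong[OF wu(3), of i] len by (simp add: append_zeros_def)
  qed
qed

lemma append_zeros_image:
  assumes "0 < N"
  shows "append_zeros ` basis_words N = {\<omega> \<in> inf_words N. \<exists>n. \<forall>k\<ge>n. \<omega> k = 0}"
proof (intro equalityI subsetI)
  fix \<omega> assume "\<omega> \<in> append_zeros ` basis_words N"
  then obtain w where w: "w \<in> basis_words N" "\<omega> = append_zeros w" by blast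
  have "\<forall>k\<ge>length w. \<omega> k = 0" by (simp add: w append_zeros_def)
  then show "\<omega> \<in> {\<omega> \<in> inf_words N. \<exists>n. \<forall>k\<ge>n. \<omega> k = 0}"
    using w assms append_zeros_less by (auto simp: inf_words_def)
next
  fix \<omega> assume "\<omega> \<in> {\<omega> \<in> inf_words N. \<exists>n. \<forall>k\<ge>n. \<omega> k = 0}"
  then obtain n where "\<forall>k. \<omega> k < N" "\<forall>k\<ge>n. \<omega> k = 0" by (auto simp: inf_words_def)
  then show "\<omega> \<in> append_zeros ` basis_words N"
  proof (induction n arbitrary: \<omega>)
    case 0
    then have "\<omega> = append_zeros []" by (simp add: fun_eq_iff)
    then show ?case by (metis Nil_in_basis_words imageI)
  next
    case (Suc n)
    then have "(\<lambda>k. \<omega> (Suc k)) \<in> append_zeros ` basis_words N" by simp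
    then obtain w where w: "w \<in> basis_words N" "(\<lambda>k. \<omega> (Suc k)) = append_zeros w" by blast
    have "\<omega> k = append_zeros (cons_word (\<omega> 0) w) k" for k
      using fun_cong[OF w(2)] by (simp add: append_zeros_cons_word split: nat.split)
    then have "\<omega> = append_zeros (cons_word (\<omega> 0) w)" by (rule ext)
    then show ?case using cons_word_in_basis_words[OF _ w(1), of "\<omega> 0"] Suc.prems by blast
  qed
qed

section \<open>Cuntz families generated by a vector fixed by the first isometry\<close>

locale cuntz_fixed_vector = cuntz_pair N S Sa
  for N and S Sa :: "nat \<Rightarrow> 'a::complex_hilbert \<Rightarrow> 'a" +
  fixes v :: 'a
  assumes N_pos: "0 < N"
    and norm_v: "norm v = 1"
    and S0_v: "S 0 v = v"
    and dense: "closure (cspan ((\<lambda>w. word_op S w v) ` basis_words N)) = UNIV"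
begin

abbreviation \<Lambda> :: "nat list set" where "\<Lambda> \<equiv> basis_words N"

abbreviation e :: "nat list \<Rightarrow> 'a" where "e \<equiv> \<lambda>w. word_op S w v"

lemma S_e: "S j (e w) = e (cons_word j w)"
  using S0_v by (rule word_op_cons_word)

text \<open>
  Since \<open>S 0\<close> fixes \<open>e []\<close>, every basis vector has this form, with no exception for the empty
  word (whose \<open>tl\<close> is again empty).
\<close>

lemma e_unfold: "w \<in> \<Lambda> \<Longrightarrow> e w = S (append_zeros w 0) (e (tl w))"
  using cons_word_eq_iff[of w N "append_zeros w 0" "tl w"] by (simp add: S_e)

lemma Sa_e:
  assumes "i < N" "w \<in> \<Lambda>"
  shows "Sa i (e w) = (if i = append_zeros w 0 then e (tl w) else 0)"
  using assms by (subst e_unfold) (auto simp: rel append_zeros_less N_pos)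

text \<open>
  Moving the first letter of \<open>w\<close> to the other side of the inner product deletes one letter from
  both words at once.
\<close>

lemma e_orthonormal:
  assumes "w \<in> \<Lambda>" "u \<in> \<Lambda>"
  shows "cinner (e w) (e u) = (if w = u then 1 else 0)"
  using assms
proof (induction "length w + length u" arbitrary: w u rule: less_induct)
  case less
  show ?case
  proof (cases "w = [] \<and> u = []")
    case True
    then show ?thesis by (simp add: cinner_self norm_v)
  next
    case False
    then have len: "length (tl w) + length (tl u) < length w + length u"
      by (cases w; cases u) auto
    have a: "append_zeros w 0 < N" using less.prems by (simp add: append_zeros_less N_pos)
    have "cinner (e w) (e u) = cinner (e (tl w)) (Sa (append_zeros w 0) (e u))"
      using less.prems(1) by (subst e_unfold) (simp_all add: adj a)
    also have "\<dots> = (if append_zeros w 0 = append_zeros u 0 \<and> tl w = tl u then 1 else 0)"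
      using less.hyps[OF len] less.prems by (auto simp: Sa_e a tl_in_basis_words)
    also have "append_zeros w 0 = append_zeros u 0 \<and> tl w = tl u \<longleftrightarrow> w = u"
      using cons_word_eq_iff[OF less.prems(1)] cons_word_eq_iff[OF less.prems(2)] by metis
    finally show ?thesis .
  qed
qed

lemma e_basis: "orthonormal_basis \<Lambda> e"
  using dense by (auto simp: orthonormal_basis_def e_orthonormal)

lemma e_eq_iff: "w \<in> \<Lambda> \<Longrightarrow> u \<in> \<Lambda> \<Longrightarrow> e w = e u \<longleftrightarrow> w = u"
  using basis_inj[OF e_basis] by (auto dest: inj_onD)

lemma permutative: "permutative_basis N S \<Lambda> e"
  unfolding permutative_basis_def S_e using e_basis cons_word_in_basis_words by blast

lemma branch_map_eq: "j < N \<Longrightarrow> w \<in> \<Lambda> \<Longrightarrow> branch_map S \<Lambda> e j w = cons_word j w"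
  unfolding branch_map_def S_e
  by (rule the_equality) (auto simp: cons_word_in_basis_words e_eq_iff)

lemma coding_shift_eq:
  assumes w: "w \<in> \<Lambda>"
  shows "coding_shift N S \<Lambda> e w = tl w"
  unfolding coding_shift_def
proof (rule the_equality)
  show "tl w \<in> \<Lambda> \<and> (\<exists>j<N. branch_map S \<Lambda> e j (tl w) = w)"
    using w append_zeros_less[OF N_pos w, of 0] cons_word_eq_iff[OF w, of "append_zeros w 0" "tl w"]
    by (auto simp: tl_in_basis_words branch_map_eq)
qed (use w in \<open>auto simp: branch_map_eq cons_word_eq_iff\<close>)

lemma coding_shift_power: "w \<in> \<Lambda> \<Longrightarrow> (coding_shift N S \<Lambda> e ^^ k) w = drop k w"
  by (induction k) (simp_all add: coding_shift_eq drop_in_basis_words drop_Suc tl_drop)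

lemma encoding_eq:
  assumes w: "w \<in> \<Lambda>"
  shows "encoding N S \<Lambda> e w = append_zeros w"
proof
  fix k
  have d: "drop k w \<in> \<Lambda>" by (rule drop_in_basis_words[OF w])
  have "drop k w \<in> branch_map S \<Lambda> e j ` \<Lambda> \<longleftrightarrow> j = append_zeros w k" if j: "j < N" for j
  proof -
    have "drop k w \<in> branch_map S \<Lambda> e j ` \<Lambda> \<longleftrightarrow> (\<exists>u\<in>\<Lambda>. cons_word j u = drop k w)"
      using j unfolding image_iff by (metis branch_map_eq)
    also have "\<dots> \<longleftrightarrow> j = append_zeros w k"
      using d tl_in_basis_words[OF d] by (auto simp: cons_word_eq_iff append_zeros_drop)
    finally show ?thesis .
  qed
  then show "encoding N S \<Lambda> e w k = append_zeros w k"
    unfolding encoding_def coding_shift_power[OF w]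
    using append_zeros_less[OF N_pos w, of k] by (intro the_equality) auto
qed

text \<open>
  The adjoint of \<open>S\<^sub>w\<close> strips the letters of \<open>w\<close> off the label of \<open>e u\<close>, failing at the first
  disagreement, and \<open>S\<^sub>w\<close> puts them back.
\<close>

lemma word_projection_e:
  assumes "set w \<subseteq> {..<N}" "u \<in> \<Lambda>"
  shows "word_op S w (fold Sa w (e u)) = (if \<forall>k<length w. append_zeros u k = w ! k then e u else 0)"
  using assms
proof (induction w arbitrary: u)
  case (Cons i w)
  then have i: "i < N" and tl: "tl u \<in> \<Lambda>" by (auto simp: tl_in_basis_words)
  have zero: "fold Sa w 0 = 0" "word_op S w 0 = 0"
    using Cons.prems(1) by (induction w) auto
  show ?case
  proof (cases "i = append_zeros u 0")
    case True
    then have "word_op S (i # w) (fold Sa (i # w) (e u)) =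
        S i (if \<forall>k<length w. append_zeros u (Suc k) = w ! k then e (tl u) else 0)"
      using Cons i tl by (simp add: Sa_e)
    also have "\<dots> = (if \<forall>k<length w. append_zeros u (Suc k) = w ! k then e u else 0)"
      using i e_unfold[OF Cons.prems(2)] True by auto
    finally show ?thesis using True by (simp add: All_less_Suc2)
  next
    case False
    then show ?thesis using Cons.prems i zero by (auto simp: Sa_e)
  qed
qed simp

text \<open>
  Both sides of the cylinder condition are tested against the basis, on which \<open>S\<^sub>w S\<^sub>w\<^sup>*\<close> is diagonal.
\<close>

lemma coord_proj_cuntz_pvm:
  "is_cuntz_pvm N S (\<lambda>B. coord_proj e {u \<in> \<Lambda>. append_zeros u \<in> B})"
  unfolding is_cuntz_pvm_def
proof (intro conjI allI impI)
  show "is_pvm (words_borel N) (\<lambda>B. coord_proj e {u \<in> \<Lambda>. append_zeros u \<in> B})"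
    using append_zeros_less[OF N_pos]
    by (intro labelled_basis_pvm[OF e_basis])
      (auto simp: words_borel_def space_restrict_space inf_words_def)
next
  fix w assume w: "set w \<subseteq> {..<N}"
  have adj_w: "cadjoint (word_op S w) = fold Sa w"
    by (rule cadjoint_eqI) (rule word_adj[OF w])
  show "coord_proj e {u \<in> \<Lambda>. append_zeros u \<in> cylinder N w} = word_op S w \<circ> cadjoint (word_op S w)"
  proof (rule ext, rule basis_eqI[OF e_basis])
    fix x u assume u: "u \<in> \<Lambda>"
    have cyl: "append_zeros u \<in> cylinder N w \<longleftrightarrow> (\<forall>k<length w. append_zeros u k = w ! k)"
      using append_zeros_less[OF N_pos u] by (auto simp: cylinder_def inf_words_def)
    have "cinner ((word_op S w \<circ> cadjoint (word_op S w)) x) (e u) =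
        cinner x (word_op S w (fold Sa w (e u)))"
      using adjoint_pair_swap[of "word_op S w" "fold Sa w" x "fold Sa w (e u)"] word_adj[OF w]
      by (simp add: adj_w)
    then show "cinner (coord_proj e {u \<in> \<Lambda>. append_zeros u \<in> cylinder N w} x) (e u) =
        cinner ((word_op S w \<circ> cadjoint (word_op S w)) x) (e u)"
      using u by (auto simp: coord_proj_coefficient[OF e_basis] cyl word_projection_e[OF w u])
  qed
qed

lemma purely_atomic: "purely_atomic_on N S {\<omega> \<in> inf_words N. \<exists>n. \<forall>k\<ge>n. \<omega> k = 0}"
  unfolding purely_atomic_on_def
proof (intro conjI exI allI)
  fix x
  have "{u \<in> \<Lambda>. append_zeros u = append_zeros w} = {w}" if "w \<in> \<Lambda>" for w
    using that inj_append_zeros[of N] by (auto dest: inj_onD)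
  then have "((\<lambda>w. coord_proj e {u \<in> \<Lambda>. append_zeros u \<in> {append_zeros w}} x) has_sum x) \<Lambda>"
    using basis_expansion[OF e_basis, of x]
    by (subst has_sum_cong[where g = "\<lambda>w. cinner x (e w) *\<^sub>C e w"])
      (auto simp: coord_proj_singleton[OF e_basis])
  then show "((\<lambda>\<omega>. coord_proj e {u \<in> \<Lambda>. append_zeros u \<in> {\<omega>}} x) has_sum x)
      {\<omega> \<in> inf_words N. \<exists>n. \<forall>k\<ge>n. \<omega> k = 0}"
    unfolding append_zeros_image[OF N_pos, symmetric]
    by (subst has_sum_reindex[OF inj_append_zeros]) (simp add: o_def)
qed (use coord_proj_cuntz_pvm in auto)

text \<open>
  Each application deletes a leading zero or annihilates the vector, and a nonempty word of the
  index set has a nonzero letter that is met within its length.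
\<close>

lemma Sa_power_e:
  "u \<in> \<Lambda> \<Longrightarrow> length u \<le> n \<Longrightarrow> (Sa 0 ^^ n) (e u) = (if u = [] then v else 0)"
proof (induction n arbitrary: u)
  case (Suc n)
  have z: "(Sa 0 ^^ n) 0 = 0" by (induction n) (auto simp: N_pos)
  have u': "tl u \<in> \<Lambda>" "length (tl u) \<le> n" using Suc.prems by (auto simp: tl_in_basis_words)
  have "append_zeros u 0 = 0 \<and> tl u = [] \<longleftrightarrow> u = []"
    using Suc.prems(1) by (cases u) (auto simp: basis_words_def)
  then show ?case
    using Suc.IH[OF u'] Suc.prems(1) z
    by (auto simp: funpow_Suc_right Sa_e N_pos simp del: funpow.simps)
qed simp

text \<open>
  On each basis vector the powers of \<open>Sa 0\<close> are eventually constant; being contractions,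
  they converge on the closed span as well.
\<close>

lemma Sa_power_tendsto: "(\<lambda>n. (Sa 0 ^^ n) x) \<longlonglongrightarrow> cinner x v *\<^sub>C v"
proof -
  define X where "X = {x. (\<lambda>n. (Sa 0 ^^ n) x) \<longlonglongrightarrow> cinner x v *\<^sub>C v}"
  note pow_adj = Sa_power_adj[OF N_pos]
  note pow_add = adjoint_pair_add[OF pow_adj] and pow_scale = adjoint_pair_scaleC[OF pow_adj]
  have pow_diff: "(Sa 0 ^^ n) (x - y) = (Sa 0 ^^ n) x - (Sa 0 ^^ n) y" for n x y
    using pow_add[of n "x - y" y] by simp
  have "X = UNIV"
  proof (rule csubspace_closed_eq_UNIV[OF _ _ _ dense])
    show "csubspace X"
    proof (rule complex_vector.subspaceI)
      have "(Sa 0 ^^ n) 0 = 0" for n by (induction n) (auto simp: N_pos)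
      then show "0 \<in> X" by (simp add: X_def)
      show "x + y \<in> X" if "x \<in> X" "y \<in> X" for x y
        using that by (auto simp: X_def pow_add cinner_add_left scaleC_add_left intro: tendsto_add)
      show "c *\<^sub>C x \<in> X" if "x \<in> X" for c x
      proof -
        have "(\<lambda>n. c *\<^sub>C (Sa 0 ^^ n) x) \<longlonglongrightarrow> c *\<^sub>C cinner x v *\<^sub>C v"
          using that by (intro bounded_linear.tendsto[OF bounded_linear_scaleC_right]) (simp add: X_def)
        then show ?thesis by (simp add: X_def pow_scale cinner_scaleC_left scaleC_scaleC)
      qed
    qed
    show "e ` \<Lambda> \<subseteq> X"
    proof clarify
      fix u assume u: "u \<in> \<Lambda>"
      have "cinner (e u) v *\<^sub>C v = (if u = [] then v else 0)"
        using e_orthonormal[OF u, of "[]"] by simp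
      moreover have "\<forall>\<^sub>F n in sequentially. (Sa 0 ^^ n) (e u) = (if u = [] then v else 0)"
        unfolding eventually_sequentially using Sa_power_e[OF u] by blast
      ultimately show "e u \<in> X" by (simp add: X_def tendsto_eventually)
    qed
    show "closed X"
      unfolding closure_subset_eq[symmetric]
    proof
      fix x assume "x \<in> closure X"
      then have approx: "\<forall>\<epsilon>>0. \<exists>y\<in>X. dist y x < \<epsilon>" by (simp add: closure_approachable)
      show "x \<in> X" unfolding X_def mem_Collect_eq
      proof (rule metric_LIMSEQ_I)
        fix \<epsilon> :: real assume "\<epsilon> > 0"
        then obtain y where y: "y \<in> X" "dist y x < \<epsilon> / 3" using approx by (meson divide_pos_pos zero_less_numeral)
        then obtain n0 where n0: "\<And>n. n \<ge> n0 \<Longrightarrow> dist ((Sa 0 ^^ n) y) (cinner y v *\<^sub>C v) < \<epsilon> / 3"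
          using metric_LIMSEQ_D[of "\<lambda>n. (Sa 0 ^^ n) y" "cinner y v *\<^sub>C v" "\<epsilon> / 3"] \<open>\<epsilon> > 0\<close>
          by (auto simp: X_def)
        have "dist ((Sa 0 ^^ n) x) (cinner x v *\<^sub>C v) < \<epsilon>" if "n \<ge> n0" for n
        proof -
          have "dist ((Sa 0 ^^ n) x) ((Sa 0 ^^ n) y) \<le> dist y x"
            using norm_Sa_power_le[OF N_pos, of n "x - y"]
            by (simp add: dist_norm pow_diff norm_minus_commute)
          moreover have "dist (cinner y v *\<^sub>C v) (cinner x v *\<^sub>C v) \<le> dist y x"
            using cinner_Cauchy_Schwarz[of "y - x" v]
            by (simp add: dist_norm norm_scaleC norm_v cinner_diff_left
                flip: complex_vector.scale_left_diff_distrib)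
          ultimately show ?thesis
            using n0[OF that] y(2)
              dist_triangle[of "(Sa 0 ^^ n) x" "cinner x v *\<^sub>C v" "(Sa 0 ^^ n) y"]
              dist_triangle[of "(Sa 0 ^^ n) y" "cinner x v *\<^sub>C v" "cinner y v *\<^sub>C v"]
            by linarith
        qed
        then show "\<exists>n0. \<forall>n\<ge>n0. dist ((Sa 0 ^^ n) x) (cinner x v *\<^sub>C v) < \<epsilon>" by blast
      qed
    qed
  qed
  then show ?thesis by (auto simp: X_def)
qed

text \<open>
  Some basis vector \<open>e u\<close> is not orthogonal to a given nonzero \<open>x \<in> M\<close>; applying the adjoint of
  \<open>S\<^sub>u\<close> gives an element of \<open>M\<close> not orthogonal to \<open>v\<close>, and the limit above extracts a
  nonzero multiple of \<open>v\<close> from it.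
\<close>

lemma coinvariant_contains_v:
  assumes M: "csubspace M" "closed M" "M \<noteq> {0}" and inv: "\<And>l. l < N \<Longrightarrow> Sa l ` M \<subseteq> M"
  shows "v \<in> M"
proof -
  obtain x where x: "x \<in> M" "x \<noteq> 0" using M(1,3) complex_vector.subspace_0 by blast
  then obtain u where u: "u \<in> \<Lambda>" "cinner x (e u) \<noteq> 0"
    using basis_vanishing_coefficients[OF e_basis] by blast
  define y where "y = fold Sa u x"
  have uN: "set u \<subseteq> {..<N}" using u(1) by (simp add: basis_words_def)
  then have y: "y \<in> M" unfolding y_def using x(1)
  proof (induction u arbitrary: x)
    case (Cons i u)
    then have "Sa i x \<in> M" using inv[of i] by auto
    then show ?case using Cons by simp
  qed simp
  have c: "cinner y v = cinner x (e u)"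
    unfolding y_def by (rule adjoint_pair_swap) (rule word_adj[OF uN])
  have "(Sa 0 ^^ n) y \<in> M" for n
    by (induction n) (use y inv[OF N_pos] in auto)
  then have "cinner y v *\<^sub>C v \<in> M"
    using closed_sequentially[OF M(2) _ Sa_power_tendsto[of y]] by blast
  then have "(1 / cinner y v) *\<^sub>C cinner y v *\<^sub>C v \<in> M"
    using M(1) complex_vector.subspace_scale by blast
  then show ?thesis using u(2) c by simp
qed

lemma irreducible: "irreducible_rep N S"
  unfolding irreducible_rep_def
proof (intro allI impI, elim conjE)
  fix M assume M: "csubspace M" "closed M" and inv: "\<forall>i<N. S i ` M \<subseteq> M \<and> cadjoint (S i) ` M \<subseteq> M"
  show "M = {0} \<or> M = UNIV"
  proof (cases "M = {0}")
    case False
    have "v \<in> M"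
      by (rule coinvariant_contains_v[OF M False]) (use inv cadjoint_S in auto)
    then have "word_op S w v \<in> M" if "set w \<subseteq> {..<N}" for w
      using that inv by (induction w) auto
    then have "e ` \<Lambda> \<subseteq> M" by (auto simp: basis_words_def)
    then show ?thesis using csubspace_closed_eq_UNIV[OF M _ dense] by blast
  qed simp
qed

lemma finite_dim_coinvariant:
  assumes "csubspace M" "finite_dim M" "M \<noteq> {0}" "\<forall>l<N. cadjoint (S l) ` M \<subseteq> M"
  shows "v \<in> M"
  by (rule coinvariant_contains_v) (use assms finite_dim_closed cadjoint_S in auto)

end

section \<open>Square integrable functions and their dominated limits\<close>

lemma abs_L2_eqI:
  assumes "sq_integrable f" "sq_integrable g" "\<And>x. 0 \<le> x \<Longrightarrow> x < 1 \<Longrightarrow> f x = g x"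
  shows "abs_L2 f = abs_L2 g"
proof -
  have "AE x in lborel. x \<noteq> (1 :: real)" by (rule AE_lborel_singleton)
  then have "AE x in UI. f x = g x"
    using assms(3) by (subst AE_restrict_space_iff) (auto elim!: eventually_mono)
  then show ?thesis using assms(1,2) by (intro Quotient_rel_abs[OF Quotient_L2]) simp
qed

lemma sq_integrable_sum:
  "(\<And>i. i \<in> I \<Longrightarrow> sq_integrable (f i)) \<Longrightarrow> sq_integrable (\<lambda>x. \<Sum>i\<in>I. f i x)"
  by (induction I rule: infinite_finite_induct) (auto intro: sq_integrable_const sq_integrable_add)

lemma abs_L2_sum:
  "(\<And>i. i \<in> I \<Longrightarrow> sq_integrable (f i)) \<Longrightarrow> abs_L2 (\<lambda>x. \<Sum>i\<in>I. f i x) = (\<Sum>i\<in>I. abs_L2 (f i))"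
proof (induction I rule: infinite_finite_induct)
  case (insert i I)
  then show ?case by (simp add: plus_L2.abs_eq[symmetric] sq_integrable_sum)
qed (simp_all add: zero_L2_def)

lemma sq_integrable_indicator: "B \<in> sets borel \<Longrightarrow> sq_integrable (indicator B)"
  by (rule sq_integrable_bounded[where B = 1])
    (auto simp: indicator_def intro: measurable_restrict_space1)

lemma sq_integrable_dominated:
  assumes g: "sq_integrable g" and f: "f \<in> borel_measurable UI"
    and le: "\<And>x. 0 \<le> x \<Longrightarrow> x \<le> 1 \<Longrightarrow> cmod (f x) \<le> cmod (g x)"
  shows "sq_integrable f"
  unfolding sq_integrable_def
proof (intro conjI f)
  show "integrable UI (\<lambda>x. (cmod (f x))\<^sup>2)"
  proof (rule Bochner_Integration.integrable_bound)
    show "integrable UI (\<lambda>x. (cmod (g x))\<^sup>2)" using g by (simp add: sq_integrable_def)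
    show "(\<lambda>x. (cmod (f x))\<^sup>2) \<in> borel_measurable UI" using f by measurable
    show "AE x in UI. norm ((cmod (f x))\<^sup>2) \<le> norm ((cmod (g x))\<^sup>2)"
      using le by (intro AE_I2) (auto intro: power_mono)
  qed
qed

lemma sq_integrable_bounded_mult:
  assumes f: "sq_integrable f" and m: "m \<in> borel_measurable UI" and B: "\<And>x. cmod (m x) \<le> B"
  shows "sq_integrable (\<lambda>x. m x * f x)"
proof (rule sq_integrable_dominated)
  show "sq_integrable (\<lambda>x. complex_of_real B * f x)" using f by (rule sq_integrable_scale)
  show "(\<lambda>x. m x * f x) \<in> borel_measurable UI"
    using f m by (auto simp: sq_integrable_def)
  show "cmod (m x * f x) \<le> cmod (complex_of_real B * f x)" for x
    using B[of x] by (auto simp: norm_mult intro!: mult_right_mono)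
qed

lemma L2_dominated_convergence:
  assumes g: "sq_integrable g" and f: "f \<in> borel_measurable UI"
    and s: "\<And>n. s n \<in> borel_measurable UI"
    and le: "\<And>n x. 0 \<le> x \<Longrightarrow> x \<le> 1 \<Longrightarrow> cmod (s n x) \<le> cmod (g x)"
    and lim: "\<And>x. 0 \<le> x \<Longrightarrow> x \<le> 1 \<Longrightarrow> (\<lambda>n. s n x) \<longlonglongrightarrow> f x"
  shows "(\<lambda>n. abs_L2 (s n)) \<longlonglongrightarrow> abs_L2 f"
proof -
  have fle: "cmod (f x) \<le> cmod (g x)" if "0 \<le> x" "x \<le> 1" for x
    using le[OF that] lim[OF that] by (intro Lim_bounded[OF tendsto_norm]) auto
  have sf: "sq_integrable f" by (rule sq_integrable_dominated[OF g f fle])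
  have ss: "sq_integrable (s n)" for n by (rule sq_integrable_dominated[OF g s le])
  have "(\<lambda>n. \<integral>x. (cmod (s n x - f x))\<^sup>2 \<partial>UI) \<longlonglongrightarrow> (\<integral>x. 0 \<partial>UI)"
  proof (rule integral_dominated_convergence)
    show "integrable UI (\<lambda>x. 4 * (cmod (g x))\<^sup>2)" using g by (simp add: sq_integrable_def)
    show "(\<lambda>x. (cmod (s n x - f x))\<^sup>2) \<in> borel_measurable UI" for n
      using s[of n] f by measurable
    show "AE x in UI. (\<lambda>n. (cmod (s n x - f x))\<^sup>2) \<longlonglongrightarrow> 0"
    proof (rule AE_I2)
      fix x assume "x \<in> space UI"
      then have "(\<lambda>n. (cmod (s n x - f x))\<^sup>2) \<longlonglongrightarrow> (cmod (f x - f x))\<^sup>2"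
        using lim[of x] by (intro tendsto_intros) auto
      then show "(\<lambda>n. (cmod (s n x - f x))\<^sup>2) \<longlonglongrightarrow> 0" by simp
    qed
    show "AE x in UI. norm ((cmod (s n x - f x))\<^sup>2) \<le> 4 * (cmod (g x))\<^sup>2" for n
    proof (rule AE_I2)
      fix x assume "x \<in> space UI"
      then have "cmod (s n x - f x) \<le> 2 * cmod (g x)"
        using norm_triangle_ineq4[of "s n x" "f x"] le[of x n] fle[of x] by simp
      then have "(cmod (s n x - f x))\<^sup>2 \<le> (2 * cmod (g x))\<^sup>2" by (intro power_mono) auto
      then show "norm ((cmod (s n x - f x))\<^sup>2) \<le> 4 * (cmod (g x))\<^sup>2" by (simp add: power_mult_distrib)
    qed
  qed simp
  then have "(\<lambda>n. (norm (abs_L2 (s n) - abs_L2 f))\<^sup>2) \<longlonglongrightarrow> 0"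
    by (simp add: abs_L2_diff ss sf norm_L2_sq sq_integrable_diff)
  then have "(\<lambda>n. sqrt ((norm (abs_L2 (s n) - abs_L2 f))\<^sup>2)) \<longlonglongrightarrow> sqrt 0"
    by (rule tendsto_real_sqrt)
  then have "(\<lambda>n. norm (abs_L2 (s n) - abs_L2 f)) \<longlonglongrightarrow> 0" by simp
  then show ?thesis by (subst LIM_zero_iff[symmetric]) (rule tendsto_norm_zero_cancel)
qed

text \<open>
  Initial segments form an intersection-stable generator of the Borel sets, and closed subspaces
  absorb complements and countable disjoint unions, so the passage from segments to all Borel sets
  is a monotone class argument.  Every function is a dominated limit of simple functions.
\<close>

lemma closed_subspace_of_segments_eq_UNIV:
  assumes D: "csubspace D" "closed D" and seg: "\<And>t. abs_L2 (indicator {..<t}) \<in> D"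
  shows "D = UNIV"
proof -
  have one: "abs_L2 (indicator UNIV) \<in> D"
  proof -
    have "abs_L2 (indicator UNIV) = abs_L2 (indicator {..<1})"
      by (rule abs_L2_eqI) (auto simp: sq_integrable_indicator sq_integrable_const)
    then show ?thesis using seg by simp
  qed
  have borel_sets: "abs_L2 (indicator B) \<in> D" if "B \<in> sets borel" for B :: "real set"
  proof -
    have borel: "sets borel = sigma_sets (UNIV :: real set) (range lessThan)"
      by (simp add: borel_Iio)
    have int: "Int_stable (range (lessThan :: real \<Rightarrow> real set))"
    proof (rule Int_stableI_image)
      show "\<exists>c\<in>UNIV. {..<a} \<inter> {..<b} = {..<c}" for a b :: real
        by (rule bexI[of _ "min a b"]) auto
    qed
    have "range (lessThan :: real \<Rightarrow> real set) \<subseteq> Pow UNIV" "B \<in> sigma_sets UNIV (range lessThan)"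
      using that by (auto simp: borel)
    with int show ?thesis
    proof (induction rule: sigma_sets_induct_disjoint)
      case (basic A)
      then show ?case using seg by auto
    next
      case empty
      have "abs_L2 (indicator {}) = 0" by (simp add: indicator_def[abs_def] zero_L2_def)
      then show ?case using complex_vector.subspace_0[OF D(1)] by (simp only:)
    next
      case (compl A)
      then have A: "A \<in> sets borel" by (simp add: borel)
      have "abs_L2 (indicator (UNIV - A)) = abs_L2 (indicator UNIV) - abs_L2 (indicator A)"
      proof -
        have "indicator (UNIV - A) = (\<lambda>x. indicator UNIV x - indicator A x :: complex)"
          by (auto simp: indicator_def fun_eq_iff)
        then show ?thesis
          using abs_L2_diff[OF sq_integrable_indicator[of UNIV] sq_integrable_indicator[OF A]] by simp
      qed
      then show ?case using one compl D(1) complex_vector.subspace_diff by simp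
    next
      case (union A)
      then have A: "A i \<in> sets borel" for i by (auto simp: borel)
      have dj: "disjoint_family_on A {..<n}" for n
        using union(1) by (auto simp: disjoint_family_on_def)
      have "abs_L2 (indicator (\<Union>i<n. A i)) = (\<Sum>i<n. abs_L2 (indicator (A i)))" for n
      proof -
        have "indicator (\<Union>i<n. A i) = (\<lambda>x. \<Sum>i<n. indicator (A i) x :: complex)"
          by (rule ext) (rule indicator_UN_disjoint[OF _ dj], simp)
        then show ?thesis by (simp add: abs_L2_sum sq_integrable_indicator A)
      qed
      then have "abs_L2 (indicator (\<Union>i<n. A i)) \<in> D" for n
        using union(3) D(1) by (auto intro: complex_vector.subspace_sum)
      moreover have "(\<lambda>n. abs_L2 (indicator (\<Union>i<n. A i))) \<longlonglongrightarrow> abs_L2 (indicator (\<Union>i. A i))"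
      proof (rule L2_dominated_convergence[where g = "\<lambda>x. 1"])
        show "(indicator (\<Union>i. A i) :: real \<Rightarrow> complex) \<in> borel_measurable UI"
          and "(indicator (\<Union>i<n. A i) :: real \<Rightarrow> complex) \<in> borel_measurable UI" for n
          using sq_integrable_indicator[of "\<Union>i. A i"] sq_integrable_indicator[of "\<Union>i<n. A i"] A
          by (simp_all add: sq_integrable_def sets.countable_UN')
        show "(\<lambda>n. indicator (\<Union>i<n. A i) x :: complex) \<longlonglongrightarrow> indicator (\<Union>i. A i) x" for x
          by (rule LIMSEQ_indicator_UN)
      qed (auto simp: sq_integrable_const indicator_def)
      ultimately show ?case by (rule closed_sequentially[OF D(2)])
    qed
  qed
  have simple: "abs_L2 s \<in> D" if s: "simple_function UI s" for s :: "real \<Rightarrow> complex"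
  proof -
    define L where "L y = s -` {y} \<inter> space UI" for y
    have L: "L y \<in> sets borel" for y
      using simple_functionD(2)[OF s, of "{y}"] by (simp add: L_def sets_restrict_space_iff)
    have fin: "finite (s ` space UI)" using s by (rule simple_functionD)
    have sum: "s x = (\<Sum>y\<in>s ` space UI. y * indicator (L y) x)" if "0 \<le> x" "x < 1" for x
    proof -
      have "s x = (\<Sum>y\<in>s ` space UI. indicator (L y) x *\<^sub>R y)"
        unfolding L_def
        by (rule simple_function_indicator_representation_banach[OF s]) (use that in simp)
      also have "\<dots> = (\<Sum>y\<in>s ` space UI. y * indicator (L y) x)"
        by (intro sum.cong refl) (simp add: indicator_def)
      finally show ?thesis .
    qed
    have int: "sq_integrable (\<lambda>x. y * indicator (L y) x)" for y
      using L by (intro sq_integrable_scale sq_integrable_indicator)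
    have "sq_integrable s"
    proof (rule sq_integrable_dominated[OF sq_integrable_const])
      show "s \<in> borel_measurable UI" using s by (rule borel_measurable_simple_function)
      show "cmod (s x) \<le> cmod (\<Sum>y\<in>s ` space UI. complex_of_real (cmod y))" if "0 \<le> x" "x \<le> 1" for x
      proof -
        have "cmod (s x) \<le> (\<Sum>y\<in>s ` space UI. cmod y)"
          using fin that by (intro member_le_sum) auto
        then show ?thesis by (simp add: sum_nonneg flip: of_real_sum)
      qed
    qed
    then have "abs_L2 s = abs_L2 (\<lambda>x. \<Sum>y\<in>s ` space UI. y * indicator (L y) x)"
      using sum int by (intro abs_L2_eqI sq_integrable_sum)
    also have "\<dots> = (\<Sum>y\<in>s ` space UI. abs_L2 (\<lambda>x. y * indicator (L y) x))"
      using int by (rule abs_L2_sum)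
    also have "\<dots> = (\<Sum>y\<in>s ` space UI. y *\<^sub>C abs_L2 (indicator (L y)))"
      using L by (simp add: scaleC_L2.abs_eq sq_integrable_indicator)
    also have "\<dots> \<in> D"
      using D(1) borel_sets[OF L] by (auto intro: complex_vector.subspace_sum complex_vector.subspace_scale)
    finally show ?thesis .
  qed
  have "F \<in> D" for F
  proof -
    obtain f where f: "sq_integrable f" "F = abs_L2 f" by (rule L2_cases)
    then have fm: "f \<in> borel_measurable UI" by (simp add: sq_integrable_def)
    obtain s where s: "\<And>i. simple_function UI (s i)" "\<And>x. x \<in> space UI \<Longrightarrow> (\<lambda>i. s i x) \<longlonglongrightarrow> f x"
      "\<And>i x. x \<in> space UI \<Longrightarrow> dist (s i x) 0 \<le> 2 * dist (f x) 0"
      using borel_measurable_implies_sequence_metric[OF fm, of 0] by metis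
    have "(\<lambda>n. abs_L2 (s n)) \<longlonglongrightarrow> abs_L2 f"
    proof (rule L2_dominated_convergence)
      show "sq_integrable (\<lambda>x. 2 * f x)" using f(1) by (rule sq_integrable_scale)
      show "s n \<in> borel_measurable UI" for n using s(1) by (rule borel_measurable_simple_function)
    qed (use fm s(2,3) in \<open>auto simp: norm_mult\<close>)
    then show ?thesis unfolding f(2) by (rule closed_sequentially[OF D(2), rotated]) (rule simple[OF s(1)])
  qed
  then show ?thesis by blast
qed

section \<open>The N-adic branches of the unit interval\<close>

definition piece :: "nat \<Rightarrow> nat \<Rightarrow> real set" where
  "piece N j = {real j / real N ..< (real j + 1) / real N}"

context
  fixes N :: nat
  assumes N: "0 < N"
begin

lemma in_piece_iff: "x \<in> piece N j \<longleftrightarrow> \<lfloor>real N * x\<rfloor> = int j"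
  using N by (auto simp: piece_def floor_eq_iff field_simps)

lemma piece_subset: "j < N \<Longrightarrow> piece N j \<subseteq> {0..<1}"
proof -
  assume "j < N"
  then have "real j + 1 \<le> real N" by linarith
  then show ?thesis using N by (auto simp: piece_def field_simps intro: order_less_le_trans)
qed

lemma ex_piece:
  assumes "0 \<le> x" "x < 1"
  obtains j where "j < N" "x \<in> piece N j"
proof -
  have "0 \<le> real N * x" "real N * x < real N" using assms N by auto
  then have "0 \<le> \<lfloor>real N * x\<rfloor>" "\<lfloor>real N * x\<rfloor> < int N" by (auto simp: floor_less_iff)
  then show ?thesis using that[of "nat \<lfloor>real N * x\<rfloor>"] by (auto simp: in_piece_iff nat_less_iff)
qed

lemma indicator_piece: "x \<in> piece N k \<Longrightarrow> indicator (piece N j) x = of_bool (j = k)"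
  by (auto simp: in_piece_iff indicator_def)

lemma times_mod_1_on_piece: "x \<in> piece N j \<Longrightarrow> times_mod_1 N x = real N * x - real j"
  by (simp add: in_piece_iff times_mod_1_def frac_def)

lemma branch_in_piece: "0 \<le> y \<Longrightarrow> y < 1 \<Longrightarrow> (y + real j) / real N \<in> piece N j"
  using N by (simp add: piece_def field_simps)

lemma times_mod_1_branch: "0 \<le> y \<Longrightarrow> y < 1 \<Longrightarrow> times_mod_1 N ((y + real j) / real N) = y"
  using N by (simp add: times_mod_1_on_piece[OF branch_in_piece])

lemma branch_times_mod_1: "x \<in> piece N j \<Longrightarrow> (times_mod_1 N x + real j) / real N = x"
  using N by (simp add: times_mod_1_on_piece)

lemma branch_unit: "j < N \<Longrightarrow> 0 \<le> y \<Longrightarrow> y \<le> 1 \<Longrightarrow> 0 \<le> (y + real j) / real N \<and> (y + real j) / real N \<le> 1"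
proof -
  assume "j < N" "0 \<le> y" "y \<le> 1"
  then have "y + real j \<le> real N" by linarith
  then show ?thesis using N \<open>0 \<le> y\<close> by simp
qed

lemma branch_measurable: "j < N \<Longrightarrow> (\<lambda>y. (y + real j) / real N) \<in> UI \<rightarrow>\<^sub>M UI"
  using branch_unit by (intro measurable_restrict_space2) (auto intro: measurable_restrict_space1)

lemma walsh_filter_on_piece:
  assumes "x \<in> piece N j" "j < N"
  shows "walsh_filter N A i x = complex_of_real (sqrt (real N)) * A $$ (i, j)"
proof -
  have "(\<Sum>k<N. A $$ (i, k) * indicator (piece N k) x) = (\<Sum>k<N. if k = j then A $$ (i, j) else 0)"
    using assms(1) by (intro sum.cong refl) (auto simp: indicator_piece)
  then show ?thesis using assms(2) by (simp add: walsh_filter_def piece_def)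
qed

lemma walsh_filter_outside:
  assumes "\<And>j. j < N \<Longrightarrow> x \<notin> piece N j"
  shows "walsh_filter N A i x = 0"
  unfolding walsh_filter_def
  using assms by (auto simp: piece_def[symmetric] indicator_def intro!: sum.neutral)

text \<open>
  The affine substitution carries the unit interval onto a piece.  Since \<open>k\<close> is measurable only
  relative to the unit interval, it is first cut off there.
\<close>

lemma integral_piece:
  fixes k :: "real \<Rightarrow> 'b::{banach, second_countable_topology}"
  assumes j: "j < N" and k: "k \<in> borel_measurable UI"
  shows "(\<integral>x. indicator (piece N j) x *\<^sub>R k x \<partial>UI) = (1 / real N) *\<^sub>R (\<integral>y. k ((y + real j) / real N) \<partial>UI)"
proof -
  define h where "h x = indicator {0..1} x *\<^sub>R k x" for x :: real
  have [measurable]: "h \<in> borel_measurable borel"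
    using k unfolding h_def by (subst (asm) borel_measurable_restrict_space_iff) auto
  have [measurable]: "piece N j \<in> sets borel" by (simp add: piece_def)
  have "(\<integral>x. indicator (piece N j) x *\<^sub>R k x \<partial>UI) = (\<integral>x. indicator (piece N j) x *\<^sub>R h x \<partial>lborel)"
    by (subst integral_restrict_space) (auto simp: h_def mult.commute)
  also have "\<dots> = (1 / real N) *\<^sub>R
      (\<integral>y. indicator (piece N j) (real j / real N + 1 / real N * y) *\<^sub>R h (real j / real N + 1 / real N * y) \<partial>lborel)"
    using N by (subst lborel_integral_real_affine[where c = "1 / real N" and t = "real j / real N"]) auto
  also have "(\<integral>y. indicator (piece N j) (real j / real N + 1 / real N * y) *\<^sub>R h (real j / real N + 1 / real N * y) \<partial>lborel)
      = (\<integral>y. indicator {0..1} y *\<^sub>R h ((y + real j) / real N) \<partial>lborel)"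
  proof (rule integral_cong_AE)
    have "real j / real N + 1 / real N * y = (y + real j) / real N" for y by (simp add: add_divide_distrib)
    moreover have "(y + real j) / real N \<in> piece N j \<longleftrightarrow> y \<in> {0..<1}" for y
      using N by (auto simp: piece_def field_simps)
    ultimately show "AE y in lborel.
        indicator (piece N j) (real j / real N + 1 / real N * y) *\<^sub>R h (real j / real N + 1 / real N * y)
        = indicator {0..1} y *\<^sub>R h ((y + real j) / real N)"
      using AE_lborel_singleton[of "1 :: real"] by (auto simp: indicator_def elim!: eventually_mono)
  qed measurable
  also have "\<dots> = (\<integral>y. h ((y + real j) / real N) \<partial>UI)"
    by (subst integral_restrict_space) auto
  also have "\<dots> = (\<integral>y. k ((y + real j) / real N) \<partial>UI)"
    using branch_unit[OF j] by (intro Bochner_Integration.integral_cong refl) (auto simp: h_def)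
  finally show ?thesis .
qed

lemma sq_integrable_branch:
  assumes j: "j < N" and g: "sq_integrable g"
  shows "sq_integrable (\<lambda>y. g ((y + real j) / real N))"
  unfolding sq_integrable_def
proof (intro conjI)
  have gm: "g \<in> borel_measurable UI" using g by (simp add: sq_integrable_def)
  show "(\<lambda>y. g ((y + real j) / real N)) \<in> borel_measurable UI"
    using measurable_compose[OF branch_measurable[OF j] gm] .
  define h where "h x = indicator {0..1} x *\<^sub>R (cmod (g x))\<^sup>2" for x :: real
  have "integrable lborel h"
    using g unfolding h_def sq_integrable_def by (subst (asm) integrable_restrict_space) auto
  then have "integrable lborel (\<lambda>y. h (real j / real N + 1 / real N * y))"
    using N by (intro lborel_integrable_real_affine) auto
  then have "integrable lborel (\<lambda>y. indicator {0..1} y *\<^sub>R h (real j / real N + 1 / real N * y))"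
    by (intro integrable_mult_indicator) auto
  moreover have "indicator {0..1} y *\<^sub>R h (real j / real N + 1 / real N * y)
      = indicator {0..1} y *\<^sub>R (cmod (g ((y + real j) / real N)))\<^sup>2" for y
    using branch_unit[OF j, of y] by (auto simp: h_def indicator_def add_divide_distrib add.commute)
  ultimately have "integrable lborel (\<lambda>y. indicator {0..1} y *\<^sub>R (cmod (g ((y + real j) / real N)))\<^sup>2)"
    by (simp only:)
  then show "integrable UI (\<lambda>y. (cmod (g ((y + real j) / real N)))\<^sup>2)"
    by (subst integrable_restrict_space) simp_all
qed

lemma sq_integrable_times_mod_1:
  assumes f: "sq_integrable f"
  shows "sq_integrable (\<lambda>x. f (times_mod_1 N x))"
  unfolding sq_integrable_def
proof (intro conjI)
  have [measurable]: "f \<in> borel_measurable UI" using f by (simp add: sq_integrable_def)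
  show "(\<lambda>x. f (times_mod_1 N x)) \<in> borel_measurable UI" by measurable
  have "integrable (distr UI UI (times_mod_1 N)) (\<lambda>x. (cmod (f x))\<^sup>2)"
    using f by (simp add: times_mod_1_preserving[OF N] sq_integrable_def)
  then show "integrable UI (\<lambda>x. (cmod (f (times_mod_1 N x)))\<^sup>2)"
    by (subst (asm) integrable_distr_eq) auto
qed

lemma sq_integrable_walsh:
  "sq_integrable f \<Longrightarrow> sq_integrable (\<lambda>x. walsh_filter N A i x * f (times_mod_1 N x))"
  by (rule sq_integrable_bounded_mult[OF sq_integrable_times_mod_1 walsh_filter_measurable walsh_filter_bounded])

lemma sq_integrable_piece_mult:
  "sq_integrable f \<Longrightarrow> sq_integrable (\<lambda>x. indicator (piece N j) x * f x)"
  by (rule sq_integrable_bounded_mult[where B = 1])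
    (auto simp: indicator_def piece_def intro: measurable_restrict_space1)

lemma walsh_op_abs:
  "sq_integrable f \<Longrightarrow> walsh_op N A i (abs_L2 f) = abs_L2 (\<lambda>x. walsh_filter N A i x * f (times_mod_1 N x))"
  by (simp add: walsh_op.abs_eq)

end

section \<open>The Walsh representation\<close>

lemma norm_one_L2: "norm one_L2 = 1"
proof -
  have "measure UI {0..1} = 1" using emeasure_UI by (simp add: measure_def)
  then have "(norm one_L2)\<^sup>2 = 1\<^sup>2" by (simp add: one_L2_def norm_L2_sq sq_integrable_const)
  then show ?thesis by (rule power2_eq_imp_eq) auto
qed

context
  fixes N :: nat and A :: "complex mat"
  assumes N: "0 < N" and U: "unitary_mat N A"
begin

lemma mat_adjoint_index: "i < N \<Longrightarrow> j < N \<Longrightarrow> mat_adjoint A $$ (j, i) = cnj (A $$ (i, j))"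
  using U by (auto simp: unitary_mat_def mat_adjoint_def mat_of_rows_index conjugate_complex_def)

lemma unitary_rows:
  assumes "i < N" "k < N"
  shows "(\<Sum>j<N. A $$ (k, j) * cnj (A $$ (i, j))) = of_bool (i = k)"
proof -
  have c: "A \<in> carrier_mat N N" and e: "A * mat_adjoint A = 1\<^sub>m N" using U by (auto simp: unitary_mat_def)
  have d: "dim_row (mat_adjoint A) = N" "dim_col (mat_adjoint A) = N"
    using c by (auto simp: mat_adjoint_def)
  have "(A * mat_adjoint A) $$ (k, i) = (\<Sum>j<N. A $$ (k, j) * cnj (A $$ (i, j)))"
    using c assms d by (simp add: scalar_prod_def mat_adjoint_index atLeast0LessThan)
  then show ?thesis using assms by (auto simp: e)
qed

lemma unitary_cols:
  assumes "j < N" "k < N"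
  shows "(\<Sum>i<N. A $$ (i, k) * cnj (A $$ (i, j))) = of_bool (j = k)"
proof -
  have c: "A \<in> carrier_mat N N" and e: "mat_adjoint A * A = 1\<^sub>m N" using U by (auto simp: unitary_mat_def)
  have d: "dim_row (mat_adjoint A) = N" "dim_col (mat_adjoint A) = N"
    using c by (auto simp: mat_adjoint_def)
  have "(mat_adjoint A * A) $$ (j, k) = (\<Sum>i<N. A $$ (i, k) * cnj (A $$ (i, j)))"
    using c assms d by (simp add: scalar_prod_def mat_adjoint_index atLeast0LessThan mult.commute)
  then show ?thesis using assms by (auto simp: e)
qed

text \<open>
  The adjoint of \<open>f \<mapsto> m\<^sub>i \<cdot> (f \<circ> R)\<close>, on functions: the sum of \<open>cnj m\<^sub>i \<cdot> g\<close> over the \<open>N\<close> preimages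
  \<open>(y + j) / N\<close> of \<open>y\<close>, divided by \<open>N\<close>.
\<close>

definition walsh_adj_fun :: "nat \<Rightarrow> (real \<Rightarrow> complex) \<Rightarrow> real \<Rightarrow> complex" where
  "walsh_adj_fun i g y =
     (\<Sum>j<N. cnj (A $$ (i, j)) / complex_of_real (sqrt (real N)) * g ((y + real j) / real N))"

lemma sq_integrable_walsh_adj: "sq_integrable g \<Longrightarrow> sq_integrable (walsh_adj_fun i g)"
  unfolding walsh_adj_fun_def[abs_def]
  by (intro sq_integrable_sum sq_integrable_scale sq_integrable_branch N) auto

lemma sqrt_N_mult: "complex_of_real (sqrt (real N)) * complex_of_real (sqrt (real N)) = of_nat N"
  by (simp flip: of_real_mult)

lemma sqrt_N_nonzero: "complex_of_real (sqrt (real N)) \<noteq> 0"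
  using N by simp

text \<open>
  The integral is split into the \<open>N\<close> pieces, where the filter is constant, and each of them is
  rescaled to the unit interval.
\<close>

lemma walsh_adj_cinner:
  assumes f: "sq_integrable f" and g: "sq_integrable g"
  shows "cinner (walsh_op N A i (abs_L2 f)) (abs_L2 g) = cinner (abs_L2 f) (abs_L2 (walsh_adj_fun i g))"
proof -
  define c where "c = complex_of_real (sqrt (real N))"
  define h where "h j x = c * A $$ (i, j) * (f (times_mod_1 N x) * cnj (g x))" for j x
  have c: "c * c = of_nat N" "c \<noteq> 0" "cnj c = c"
    unfolding c_def by (rule sqrt_N_mult sqrt_N_nonzero complex_cnj_complex_of_real)+
  have h: "integrable UI (h j)" for j
    unfolding h_def by (intro integrable_mult_right sq_integrable_mult sq_integrable_times_mod_1 N f g)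
  have branch: "integrable UI (\<lambda>y. f y * cnj (g ((y + real j) / real N)))" if "j < N" for j
    by (intro sq_integrable_mult sq_integrable_branch f g N that)
  have split: "walsh_filter N A i x * f (times_mod_1 N x) * cnj (g x)
      = (\<Sum>j<N. indicator (piece N j) x *\<^sub>R h j x)" for x
  proof (cases "\<exists>k<N. x \<in> piece N k")
    case True
    then obtain k where k: "k < N" "x \<in> piece N k" by blast
    have "(\<Sum>j<N. indicator (piece N j) x *\<^sub>R h j x) = (\<Sum>j<N. if j = k then h k x else 0)"
      using k by (intro sum.cong refl) (auto simp: indicator_piece[OF N])
    then show ?thesis using k by (simp add: walsh_filter_on_piece[OF N] h_def c_def)
  next
    case False
    then show ?thesis by (simp add: walsh_filter_outside[OF N])
  qed
  have "cinner (walsh_op N A i (abs_L2 f)) (abs_L2 g)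
      = (\<integral>x. walsh_filter N A i x * f (times_mod_1 N x) * cnj (g x) \<partial>UI)"
    using f g by (simp add: walsh_op_abs[OF N] cinner_L2.abs_eq sq_integrable_walsh[OF N])
  also have "\<dots> = (\<Sum>j<N. \<integral>x. indicator (piece N j) x *\<^sub>R h j x \<partial>UI)"
    unfolding split
  proof (rule Bochner_Integration.integral_sum)
    fix j assume "j \<in> {..<N}"
    then have "piece N j \<subseteq> {0..1}" using piece_subset[OF N, of j] by force
    moreover have "piece N j \<in> sets borel" by (simp add: piece_def)
    ultimately have "piece N j \<in> sets UI" by (subst sets_restrict_space_iff) auto
    from this h show "integrable UI (\<lambda>x. indicator (piece N j) x *\<^sub>R h j x)"
      by (rule integrable_mult_indicator)
  qed
  also have "\<dots> = (\<Sum>j<N. (1 / real N) *\<^sub>R (\<integral>y. h j ((y + real j) / real N) \<partial>UI))"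
    by (intro sum.cong refl integral_piece N borel_measurable_integrable h) auto
  also have "\<dots> = (\<Sum>j<N. \<integral>y. A $$ (i, j) / c * (f y * cnj (g ((y + real j) / real N))) \<partial>UI)"
  proof (intro sum.cong refl)
    fix j assume "j \<in> {..<N}"
    then have j: "j < N" by simp
    have "(\<integral>y. h j ((y + real j) / real N) \<partial>UI)
        = (\<integral>y. c * A $$ (i, j) * (f y * cnj (g ((y + real j) / real N))) \<partial>UI)"
    proof (rule integral_cong_AE)
      show "(\<lambda>y. h j ((y + real j) / real N)) \<in> borel_measurable UI"
        by (rule measurable_compose[OF branch_measurable[OF N j] borel_measurable_integrable[OF h]])
      show "(\<lambda>y. c * A $$ (i, j) * (f y * cnj (g ((y + real j) / real N)))) \<in> borel_measurable UI"
        using branch[OF j] by (intro borel_measurable_integrable integrable_mult_right)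
      show "AE y in UI. h j ((y + real j) / real N) = c * A $$ (i, j) * (f y * cnj (g ((y + real j) / real N)))"
        using AE_lborel_singleton[of "1 :: real"]
        by (subst AE_restrict_space_iff) (auto simp: h_def times_mod_1_branch[OF N] elim!: eventually_mono)
    qed
    then show "(1 / real N) *\<^sub>R (\<integral>y. h j ((y + real j) / real N) \<partial>UI)
        = (\<integral>y. A $$ (i, j) / c * (f y * cnj (g ((y + real j) / real N))) \<partial>UI)"
      using c N by (simp add: scaleR_conv_of_real field_simps flip: c(1))
  qed
  also have "\<dots> = (\<integral>y. (\<Sum>j<N. A $$ (i, j) / c * (f y * cnj (g ((y + real j) / real N)))) \<partial>UI)"
    using branch by (intro Bochner_Integration.integral_sum[symmetric] integrable_mult_right) auto
  also have "\<dots> = (\<integral>y. f y * cnj (walsh_adj_fun i g y) \<partial>UI)"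
    by (simp add: walsh_adj_fun_def sum_distrib_left c(3) mult_ac flip: c_def)
  also have "\<dots> = cinner (abs_L2 f) (abs_L2 (walsh_adj_fun i g))"
    using f g by (simp add: cinner_L2.abs_eq sq_integrable_walsh_adj)
  finally show ?thesis .
qed

text \<open>
  Any representative may be chosen, because the inner products with all of \<open>L2\<close> determine the result;
  see \<open>walsh_adj_abs\<close>.
\<close>

definition walsh_adj :: "nat \<Rightarrow> L2 \<Rightarrow> L2" where
  "walsh_adj i G = abs_L2 (walsh_adj_fun i (SOME g. sq_integrable g \<and> G = abs_L2 g))"

lemma walsh_adjoint: "cinner (walsh_op N A i F) G = cinner F (walsh_adj i G)"
proof -
  obtain f where f: "sq_integrable f" "F = abs_L2 f" by (rule L2_cases)
  have "\<exists>g. sq_integrable g \<and> G = abs_L2 g" by (rule L2_cases) blast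
  then have "sq_integrable (SOME g. sq_integrable g \<and> G = abs_L2 g) \<and>
      G = abs_L2 (SOME g. sq_integrable g \<and> G = abs_L2 g)" by (rule someI_ex)
  then show ?thesis using walsh_adj_cinner[OF f(1)] f(2) by (metis walsh_adj_def)
qed

lemma walsh_adj_abs:
  assumes g: "sq_integrable g"
  shows "walsh_adj i (abs_L2 g) = abs_L2 (walsh_adj_fun i g)"
proof -
  have "cinner F (walsh_adj i (abs_L2 g)) = cinner F (abs_L2 (walsh_adj_fun i g))" for F
    by (metis L2_cases walsh_adj_cinner[OF _ g] walsh_adjoint)
  then show ?thesis
    using cinner_commute[of "walsh_adj i (abs_L2 g)"] cinner_commute[of "abs_L2 (walsh_adj_fun i g)"]
    by (intro cinner_eqI) simp
qed

text \<open>
  All preimages of \<open>y\<close> see the same value \<open>f y\<close>, so only the inner product of two rows of the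
  matrix remains.
\<close>

lemma walsh_adj_fun_filter:
  assumes "i < N" "k < N" "0 \<le> y" "y < 1"
  shows "walsh_adj_fun i (\<lambda>x. walsh_filter N A k x * f (times_mod_1 N x)) y = of_bool (i = k) * f y"
proof -
  have "walsh_adj_fun i (\<lambda>x. walsh_filter N A k x * f (times_mod_1 N x)) y
      = (\<Sum>j<N. A $$ (k, j) * cnj (A $$ (i, j)) * f y)"
    unfolding walsh_adj_fun_def
    using assms sqrt_N_nonzero
    by (intro sum.cong refl) (simp add: times_mod_1_branch[OF N] walsh_filter_on_piece[OF N branch_in_piece[OF N]])
  then show ?thesis using unitary_rows[OF assms(1,2)] by (simp flip: sum_distrib_right)
qed

text \<open>
  On the piece containing \<open>x\<close> the sum over the family is an inner product of columns, which selects
  among the preimages of \<open>N x mod 1\<close> the point \<open>x\<close> itself.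
\<close>

lemma sum_filter_adj_fun:
  assumes "0 \<le> x" "x < 1"
  shows "(\<Sum>i<N. walsh_filter N A i x * walsh_adj_fun i g (times_mod_1 N x)) = g x"
proof -
  obtain k where k: "k < N" "x \<in> piece N k" using ex_piece[OF N assms] .
  let ?g = "\<lambda>j. g ((times_mod_1 N x + real j) / real N)"
  have "(\<Sum>i<N. walsh_filter N A i x * walsh_adj_fun i g (times_mod_1 N x))
      = (\<Sum>i<N. \<Sum>j<N. A $$ (i, k) * cnj (A $$ (i, j)) * ?g j)"
    unfolding walsh_adj_fun_def
    using k sqrt_N_nonzero by (simp add: walsh_filter_on_piece[OF N] sum_distrib_left mult.assoc)
  also have "\<dots> = (\<Sum>j<N. \<Sum>i<N. A $$ (i, k) * cnj (A $$ (i, j)) * ?g j)"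
    by (rule sum.swap)
  also have "\<dots> = (\<Sum>j<N. of_bool (j = k) * ?g j)"
    using unitary_cols k(1) by (intro sum.cong refl) (simp flip: sum_distrib_right)
  also have "\<dots> = (\<Sum>j<N. if j = k then ?g k else 0)" by (intro sum.cong) auto
  also have "\<dots> = g x" using k by (simp add: branch_times_mod_1[OF N])
  finally show ?thesis .
qed

lemma walsh_cuntz_pair: "cuntz_pair N (walsh_op N A) walsh_adj"
proof
  fix i x y
  show "cinner (walsh_op N A i x) y = cinner x (walsh_adj i y)" by (rule walsh_adjoint)
next
  fix i j x assume ij: "i < N" "j < N"
  obtain f where f: "sq_integrable f" "x = abs_L2 f" by (rule L2_cases)
  have "walsh_adj i (walsh_op N A j x)
      = abs_L2 (walsh_adj_fun i (\<lambda>x. walsh_filter N A j x * f (times_mod_1 N x)))"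
    using f by (simp add: walsh_op_abs[OF N] walsh_adj_abs sq_integrable_walsh[OF N])
  also have "\<dots> = abs_L2 (\<lambda>y. of_bool (i = j) * f y)"
    using ij f(1)
    by (intro abs_L2_eqI sq_integrable_walsh_adj sq_integrable_walsh[OF N] sq_integrable_scale walsh_adj_fun_filter)
  also have "\<dots> = (if i = j then x else 0)" using f(2) by (simp add: zero_L2_def)
  finally show "walsh_adj i (walsh_op N A j x) = (if i = j then x else 0)" .
next
  fix x
  obtain g where g: "sq_integrable g" "x = abs_L2 g" by (rule L2_cases)
  have "(\<Sum>i<N. walsh_op N A i (walsh_adj i x))
      = abs_L2 (\<lambda>x. \<Sum>i<N. walsh_filter N A i x * walsh_adj_fun i g (times_mod_1 N x))"
    using g by (simp add: walsh_adj_abs walsh_op_abs[OF N] sq_integrable_walsh_adj abs_L2_sum sq_integrable_walsh[OF N])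
  also have "\<dots> = x"
    unfolding g(2) using g(1)
    by (intro abs_L2_eqI sq_integrable_sum sq_integrable_walsh[OF N] sq_integrable_walsh_adj sum_filter_adj_fun)
  finally show "(\<Sum>i<N. walsh_op N A i (walsh_adj i x)) = x" .
qed

text \<open>
  Inverting the unitary matrix isolates a single branch: it is a linear combination of the
  operators of the family.
\<close>

lemma branch_as_walsh_combination:
  assumes f: "sq_integrable f" and j: "j < N"
  shows "abs_L2 (\<lambda>x. indicator (piece N j) x * f (times_mod_1 N x))
    = (\<Sum>i<N. (cnj (A $$ (i, j)) / complex_of_real (sqrt (real N))) *\<^sub>C walsh_op N A i (abs_L2 f))"
proof -
  define c where "c = complex_of_real (sqrt (real N))"
  have c: "c \<noteq> 0" unfolding c_def by (rule sqrt_N_nonzero)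
  have "(\<Sum>i<N. (cnj (A $$ (i, j)) / c) *\<^sub>C walsh_op N A i (abs_L2 f))
      = abs_L2 (\<lambda>x. \<Sum>i<N. cnj (A $$ (i, j)) / c * (walsh_filter N A i x * f (times_mod_1 N x)))"
    using f
    by (subst abs_L2_sum)
      (simp_all add: walsh_op_abs[OF N] scaleC_L2.abs_eq sq_integrable_walsh[OF N] sq_integrable_scale del: times_divide_eq_left)
  also have "\<dots> = abs_L2 (\<lambda>x. indicator (piece N j) x * f (times_mod_1 N x))"
  proof (rule abs_L2_eqI)
    fix x :: real assume "0 \<le> x" "x < 1"
    then obtain k where k: "k < N" "x \<in> piece N k" using ex_piece[OF N] by metis
    have "(\<Sum>i<N. cnj (A $$ (i, j)) / c * (walsh_filter N A i x * f (times_mod_1 N x)))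
        = (\<Sum>i<N. A $$ (i, k) * cnj (A $$ (i, j)) * f (times_mod_1 N x))"
      using k c by (intro sum.cong refl) (simp add: walsh_filter_on_piece[OF N] flip: c_def)
    also have "\<dots> = of_bool (j = k) * f (times_mod_1 N x)"
      using unitary_cols[OF j k(1)] by (simp flip: sum_distrib_right)
    finally show "(\<Sum>i<N. cnj (A $$ (i, j)) / c * (walsh_filter N A i x * f (times_mod_1 N x)))
        = indicator (piece N j) x * f (times_mod_1 N x)"
      using k by (simp add: indicator_piece[OF N])
  qed (intro sq_integrable_sum sq_integrable_scale sq_integrable_walsh sq_integrable_piece_mult
      sq_integrable_times_mod_1 N f)+
  finally show ?thesis by (simp add: c_def)
qed

text \<open>
  The set of \<open>t\<close> in the unit interval for which the indicator of \<open>{..<t}\<close> lies in \<open>D\<close> contains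
  the end points and is mapped into itself by every inverse branch \<open>t \<mapsto> (j + t) / N\<close>.  Hence it
  contains all \<open>N\<close>-adic rationals, and it is closed.
\<close>

lemma walsh_invariant_eq_UNIV:
  assumes N2: "2 \<le> N" and D: "csubspace D" "closed D"
    and inv: "\<And>i F. i < N \<Longrightarrow> F \<in> D \<Longrightarrow> walsh_op N A i F \<in> D" and one: "one_L2 \<in> D"
  shows "D = UNIV"
proof -
  have branch: "abs_L2 (\<lambda>x. indicator (piece N j) x * f (times_mod_1 N x)) \<in> D"
    if "sq_integrable f" "abs_L2 f \<in> D" "j < N" for f j
    using that D(1) inv
    by (auto simp: branch_as_walsh_combination intro!: complex_vector.subspace_sum complex_vector.subspace_scale)
  have one': "abs_L2 (\<lambda>x. 1) \<in> D" using one by (simp add: one_L2_def)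
  have seg: "sq_integrable (indicator {..<t})" for t :: real by (rule sq_integrable_indicator) simp
  have step: "abs_L2 (indicator {..<(real j + t) / real N}) \<in> D"
    if t: "0 \<le> t" "t \<le> 1" "abs_L2 (indicator {..<t}) \<in> D" and j: "j < N" for t j
  proof -
    have left: "sq_integrable (\<lambda>x. indicator (piece N i) x * 1)" for i
      by (rule sq_integrable_piece_mult[OF N sq_integrable_const])
    have last: "sq_integrable (\<lambda>x. indicator (piece N j) x * indicator {..<t} (times_mod_1 N x))"
      by (rule sq_integrable_piece_mult[OF N sq_integrable_times_mod_1[OF N seg]])
    have "abs_L2 (indicator {..<(real j + t) / real N})
        = abs_L2 (\<lambda>x. (\<Sum>i<j. indicator (piece N i) x * 1) + indicator (piece N j) x * indicator {..<t} (times_mod_1 N x))"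
    proof (rule abs_L2_eqI)
      fix x :: real assume "0 \<le> x" "x < 1"
      then obtain k where k: "k < N" "x \<in> piece N k" using ex_piece[OF N] by metis
      have b: "real k \<le> real N * x" "real N * x < real k + 1"
        using k N by (auto simp: piece_def field_simps)
      have "x < (real j + t) / real N \<longleftrightarrow> real N * x < real j + t" using N by (simp add: field_simps)
      also have "\<dots> \<longleftrightarrow> k < j \<or> k = j \<and> real N * x - real k < t"
      proof (cases k j rule: linorder_cases)
        case less
        then have "real k + 1 \<le> real j" by linarith
        then show ?thesis using less b t(1) by linarith
      next
        case greater
        then have "real j + 1 \<le> real k" by linarith
        then show ?thesis using greater b t(2) by linarith
      qed auto
      finally have lt: "x < (real j + t) / real N \<longleftrightarrow> k < j \<or> k = j \<and> times_mod_1 N x < t"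
        by (simp add: times_mod_1_on_piece[OF N k(2)])
      have sum: "(\<Sum>i<j. indicator (piece N i) x * 1) = (of_bool (k < j) :: complex)"
        using k by (simp add: indicator_piece[OF N] of_bool_def)
      show "indicator {..<(real j + t) / real N} x
          = (\<Sum>i<j. indicator (piece N i) x * 1) + indicator (piece N j) x * (indicator {..<t} (times_mod_1 N x) :: complex)"
        unfolding sum indicator_piece[OF N k(2)] using lt by (auto simp: indicator_def)
    qed (rule seg, rule sq_integrable_add[OF sq_integrable_sum[OF left] last])
    also have "\<dots> = (\<Sum>i<j. abs_L2 (\<lambda>x. indicator (piece N i) x * 1))
        + abs_L2 (\<lambda>x. indicator (piece N j) x * indicator {..<t} (times_mod_1 N x))"
      by (subst abs_L2_sum[OF left, symmetric], subst plus_L2.abs_eq)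
        (simp_all only: sq_integrable_sum[OF left] last, simp_all)
    also have "\<dots> \<in> D"
      using branch[OF sq_integrable_const one'] branch[OF seg t(3) j] j D(1)
      by (intro complex_vector.subspace_add complex_vector.subspace_sum) auto
    finally show ?thesis .
  qed
  have seg1: "abs_L2 (indicator {..<t}) \<in> D" if "1 \<le> t" for t
  proof -
    have "abs_L2 (indicator {..<t}) = abs_L2 (\<lambda>x. 1)"
      using that by (intro abs_L2_eqI seg sq_integrable_const) auto
    then show ?thesis using one' by simp
  qed
  have seg0: "abs_L2 (indicator {..<t}) \<in> D" if "t \<le> 0" for t
  proof -
    have "abs_L2 (indicator {..<t}) = abs_L2 (\<lambda>x. 0)"
      using that by (intro abs_L2_eqI seg sq_integrable_const) auto
    then show ?thesis using D(1) complex_vector.subspace_0 by (simp add: zero_L2_def[symmetric])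
  qed
  have adic: "abs_L2 (indicator {..<real m / real N ^ n}) \<in> D" if "m \<le> N ^ n" for m n
    using that
  proof (induction n arbitrary: m)
    case 0
    then show ?case using seg0[of 0] seg1[of 1] by (cases "m = 0") (auto simp: le_Suc_eq)
  next
    case (Suc n)
    \<comment> \<open>The right end point is treated separately: its leading digit would be \<open>N\<close>.\<close>
    show ?case
    proof (cases "m = N ^ Suc n")
      case True
      then show ?thesis using seg1[of 1] N by simp
    next
      case False
      define j r where "j = m div N ^ n" and "r = m mod N ^ n"
      have r: "r < N ^ n" using N by (simp add: r_def)
      have "m < N ^ n * N" using False Suc.prems by (simp add: mult.commute)
      then have j: "j < N" unfolding j_def using N by (simp add: less_mult_imp_div_less mult.commute)
      have "m = j * N ^ n + r" unfolding j_def r_def by (rule div_mult_mod_eq[symmetric])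
      then have eq: "real m / real N ^ Suc n = (real j + real r / real N ^ n) / real N"
        using N by (simp add: field_simps)
      have "real r \<le> real N ^ n" using r by (metis less_imp_le of_nat_le_iff of_nat_power)
      then have "real r / real N ^ n \<le> 1" using N by simp
      then show ?thesis unfolding eq using Suc.IH[of r] r j by (intro step) auto
    qed
  qed
  show ?thesis
  proof (rule closed_subspace_of_segments_eq_UNIV[OF D])
    fix t :: real
    show "abs_L2 (indicator {..<t}) \<in> D"
    proof (cases "0 \<le> t \<and> t \<le> 1")
      case False
      then show ?thesis using seg0[of t] seg1[of t] by linarith
    next
      case True
      \<comment> \<open>Approximation from below makes the indicators converge at \<open>x = t\<close> too.\<close>
      define m where "m n = nat \<lfloor>t * real N ^ n\<rfloor>" for n
      have m: "real (m n) \<le> t * real N ^ n" "t * real N ^ n < real (m n) + 1" for n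
        using True by (simp_all add: m_def)
      have mle: "m n \<le> N ^ n" for n
      proof -
        have "t * real N ^ n \<le> 1 * real N ^ n" using True by (intro mult_right_mono) auto
        then have "real (m n) \<le> real N ^ n" using m(1)[of n] by linarith
        then show ?thesis by (metis of_nat_le_iff of_nat_power)
      qed
      define a where "a n = real (m n) / real N ^ n" for n
      have a: "a n \<le> t" "t - a n \<le> (1 / real N) ^ n" for n
      proof -
        have P: "0 < real N ^ n" using N by simp
        show "a n \<le> t" unfolding a_def using m(1)[of n] P by (simp add: pos_divide_le_eq)
        have "t \<le> (real (m n) + 1) / real N ^ n" using m(2)[of n] P by (simp add: pos_le_divide_eq)
        then show "t - a n \<le> (1 / real N) ^ n" by (simp add: a_def add_divide_distrib power_one_over)
      qed
      have "(\<lambda>n. (1 / real N) ^ n) \<longlonglongrightarrow> 0" using N2 by (intro LIMSEQ_power_zero) auto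
      then have "(\<lambda>n. t - a n) \<longlonglongrightarrow> 0"
        by (rule tendsto_sandwich[OF _ _ tendsto_const, rotated 2]) (use a in auto)
      then have alim: "a \<longlonglongrightarrow> t"
        using tendsto_diff[OF tendsto_const[of t], of "\<lambda>n. t - a n" 0 sequentially] by simp
      have "(\<lambda>n. abs_L2 (indicator {..<a n})) \<longlonglongrightarrow> abs_L2 (indicator {..<t})"
      proof (rule L2_dominated_convergence[where g = "\<lambda>x. 1"])
        fix x :: real
        show "(\<lambda>n. indicator {..<a n} x :: complex) \<longlonglongrightarrow> indicator {..<t} x"
        proof (cases "x < t")
          case True
          then have "\<forall>\<^sub>F n in sequentially. x < a n" using alim by (simp add: order_tendsto_iff)
          then show ?thesis using True by (intro tendsto_eventually) (auto elim!: eventually_mono)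
        next
          case False
          then have "x \<notin> {..<a n}" for n using a(1)[of n] by auto
          then show ?thesis using False by simp
        qed
      qed (use seg in \<open>auto simp: sq_integrable_const sq_integrable_def indicator_def\<close>)
      moreover have "abs_L2 (indicator {..<a n}) \<in> D" for n unfolding a_def by (rule adic[OF mle])
      ultimately show ?thesis using closed_sequentially[OF D(2), of "\<lambda>n. abs_L2 (indicator {..<a n})"] by blast
    qed
  qed
qed

text \<open>
  Each operator maps the spanning set into itself by the prefixing rule, hence by continuity also its
  closed span.
\<close>

lemma walsh_dense:
  assumes N2: "2 \<le> N" and fixed: "walsh_op N A 0 one_L2 = one_L2"
  shows "closure (cspan ((\<lambda>w. word_op (walsh_op N A) w one_L2) ` basis_words N)) = UNIV"
    (is "closure (cspan ?B) = _")
proof (rule walsh_invariant_eq_UNIV[OF N2])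
  interpret cuntz_pair N "walsh_op N A" walsh_adj by (rule walsh_cuntz_pair)
  show "csubspace (closure (cspan ?B))" by (rule csubspace_closure) (rule complex_vector.subspace_span)
  show "closed (closure (cspan ?B))" by (rule closed_closure)
  have base: "?B \<subseteq> closure (cspan ?B)"
    by (rule order_trans[OF complex_vector.span_superset closure_subset])
  have "one_L2 \<in> ?B" by (rule image_eqI[of _ _ "[]"]) simp_all
  then show "one_L2 \<in> closure (cspan ?B)" by (rule subsetD[OF base])
  fix i F assume i: "i < N" and F: "F \<in> closure (cspan ?B)"
  have bl: "bounded_linear (walsh_op N A i)"
    using bounded_clinear_S[OF i] by (simp add: bounded_clinear_def)
  let ?V = "walsh_op N A i -` closure (cspan ?B)"
  have "?B \<subseteq> ?V"
  proof (rule image_subsetI, rule vimageI2)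
    fix w assume "w \<in> basis_words N"
    then have "word_op (walsh_op N A) (cons_word i w) one_L2 \<in> ?B"
      using cons_word_in_basis_words[OF i] by blast
    then have "walsh_op N A i (word_op (walsh_op N A) w one_L2) \<in> ?B"
      by (simp only: word_op_cons_word[of "walsh_op N A" one_L2 i w, OF fixed])
    then show "walsh_op N A i (word_op (walsh_op N A) w one_L2) \<in> closure (cspan ?B)"
      by (rule subsetD[OF base])
  qed
  moreover have "csubspace ?V"
  proof -
    have D: "csubspace (closure (cspan ?B))" by (rule csubspace_closure) (rule complex_vector.subspace_span)
    show ?thesis
      using D adjoint_pair_add[of "walsh_op N A i" "walsh_adj i"] adjoint_pair_scaleC[of "walsh_op N A i" "walsh_adj i"]
      by (auto intro!: complex_vector.subspaceI simp: adj[OF i] S_zero[OF i]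
          complex_vector.subspace_0 complex_vector.subspace_add complex_vector.subspace_scale)
  qed
  ultimately have "cspan ?B \<subseteq> ?V" by (rule complex_vector.span_minimal)
  moreover have "closed ?V"
    by (intro continuous_closed_vimage closed_closure) (simp add: linear_continuous_at bl)
  ultimately have "closure (cspan ?B) \<subseteq> ?V" by (rule closure_minimal)
  then show "walsh_op N A i F \<in> closure (cspan ?B)" using F by blast
qed

lemma walsh_op_zero_one:
  assumes row: "\<And>j. j < N \<Longrightarrow> A $$ (0, j) = 1 / complex_of_real (sqrt (real N))"
  shows "walsh_op N A 0 one_L2 = one_L2"
proof -
  have "walsh_op N A 0 one_L2 = abs_L2 (\<lambda>x. walsh_filter N A 0 x * 1)"
    by (simp add: one_L2_def walsh_op_abs[OF N] sq_integrable_const)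
  also have "\<dots> = abs_L2 (\<lambda>x. 1)"
  proof (rule abs_L2_eqI)
    fix x :: real assume "0 \<le> x" "x < 1"
    then obtain k where k: "k < N" "x \<in> piece N k" using ex_piece[OF N] by metis
    then show "walsh_filter N A 0 x * 1 = 1"
      using row[OF k(1)] N by (simp add: walsh_filter_on_piece[OF N])
  qed (use sq_integrable_walsh[OF N sq_integrable_const] sq_integrable_const in blast)+
  finally show ?thesis by (simp add: one_L2_def)
qed

end

theorem theorem5p19:
  fixes N :: nat and A :: "complex mat"
    and S :: "nat \<Rightarrow> L2 \<Rightarrow> L2" and \<Lambda> :: "nat list set" and e :: "nat list \<Rightarrow> L2"
  assumes "N \<ge> 2"
    and "unitary_mat N A"
    and "\<forall>j<N. A $$ (0, j) = 1 / complex_of_real (sqrt (real N))"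
    and "S = walsh_op N A"
    and "\<Lambda> = basis_words N"
    and "e = (\<lambda>w. word_op S w one_L2)"
  shows "cuntz_rep N S \<and>
    permutative_basis N S \<Lambda> e \<and>
    (\<forall>w\<in>\<Lambda>. encoding N S \<Lambda> e w = append_zeros w) \<and>
    inj_on (encoding N S \<Lambda> e) \<Lambda> \<and>
    branch_map S \<Lambda> e 0 [] = [] \<and>
    (\<forall>l<N. l \<noteq> 0 \<longrightarrow> branch_map S \<Lambda> e l [] = [l]) \<and>
    (\<forall>l<N. \<forall>w\<in>\<Lambda>. w \<noteq> [] \<longrightarrow> branch_map S \<Lambda> e l w = l # w) \<and>
    irreducible_rep N S \<and>
    purely_atomic_on N S {\<omega> \<in> inf_words N. \<exists>n. \<forall>k\<ge>n. \<omega> k = 0} \<and>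
    (\<forall>M. csubspace M \<and> finite_dim M \<and> M \<noteq> {0} \<and> (\<forall>l<N. cadjoint (S l) ` M \<subseteq> M)
       \<longrightarrow> one_L2 \<in> M)"
proof -
  have N: "0 < N" using assms(1) by simp
  have fixed: "walsh_op N A 0 one_L2 = one_L2"
    using assms(3) by (intro walsh_op_zero_one[OF N assms(2)]) simp
  interpret cuntz_fixed_vector N S "walsh_adj N A" one_L2
    unfolding assms(4)
    by (intro cuntz_fixed_vector.intro cuntz_fixed_vector_axioms.intro walsh_cuntz_pair[OF N assms(2)]
        N norm_one_L2 fixed walsh_dense[OF N assms(2,1) fixed])
  have "inj_on (encoding N S \<Lambda> e) \<Lambda>"
    unfolding assms(5,6)
    using inj_append_zeros[of N] by (simp add: inj_on_def encoding_eq)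
  moreover have "branch_map S \<Lambda> e l w = cons_word l w" if "l < N" "w \<in> \<Lambda>" for l w
    using that unfolding assms(5,6) by (rule branch_map_eq)
  moreover have "cuntz_rep N S" by (rule cuntz_rep)
  moreover have "permutative_basis N S \<Lambda> e" unfolding assms(5,6) by (rule permutative)
  moreover have "\<forall>w\<in>\<Lambda>. encoding N S \<Lambda> e w = append_zeros w"
    unfolding assms(5,6) by (blast intro: encoding_eq)
  moreover have "[] \<in> \<Lambda>" by (simp add: assms(5))
  moreover have "\<forall>M. csubspace M \<and> finite_dim M \<and> M \<noteq> {0} \<and> (\<forall>l<N. cadjoint (S l) ` M \<subseteq> M)
      \<longrightarrow> one_L2 \<in> M"
    by (blast intro: finite_dim_coinvariant)
  ultimately show ?thesis
    using N irreducible purely_atomic by (simp add: cons_word_def)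
qed

end
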